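(* The set $$\mathcal A_\infty=\{a\in\mathrm{UHF}(3^\infty):\ a=\lim_{n\to\infty}a_n \text{ in norm, for some sequence } a_n\in\mathcal A_n\}$$ is a $C^*$-algebra containing $C(K)$ as an abelian subalgebra.
   Context: Indices $j\in\{1,2,3\}$ are taken mod $3$. $M_3(\mathbb C)$ has matrix units $e_{ij}$, and $\mathbb C^3$ is identified with its diagonal subalgebra. $\mathrm{UHF}(3^\infty)$ is the $C^*$-inductive limit of $M_3(\mathbb C)^{\otimes n}$ under $x\mapsto x\otimes I_3$; each $M_3(\mathbb C)^{\otimes n}$ is regarded as a unital subalgebra of it. For $n\ge0$ put $\alpha^n_j=e_{jj}\otimes e_{22}^{\otimes n}\in M_3(\mathbb C)^{\otimes(n+1)}$, and for $k\ge1$ put $\beta^k_j=(e_{jj}\otimes e_{11}+e_{j+2,j+2}\otimes e_{33})\otimes e_{22}^{\otimes(k-1)}\in M_3(\mathbb C)^{\otimes(k+1)}$. The finite-dimensional $*$-algebra $\mathcal A_n\subset M_3(\mathbb C)^{\otimes(n+1)}\subset\mathrm{UHF}(3^\infty)$ is the linear span of the $\alpha^n_j$ and of the $x\otimes\beta^k_j$ with $j=1,2,3$, $k=1,\dots,n$, $x\in M_3(\mathbb C)^{\otimes(n-k)}$. The embedding of $C(K)$: let $v_1,v_2,v_3$ be the vertices of an equilateral triangle in $\mathbb R^2$ and let $w_j$ be the similitude of ratio $1/2$ (affine map) with $w_j(v_2)=v_j$, $w_j(v_3)=\tfrac12(v_j+v_{j+1})$, $w_j(v_1)=\tfrac12(v_j+v_{j-1})$.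 The Sierpinski gasket $K$ is the unique nonempty compact set with $K=\bigcup_j w_j(K)$. Let $\Sigma_\infty=\{1,2,3\}^{\mathbb N}$ (product topology) and $P:\Sigma_\infty\to K$ the continuous surjection sending $\sigma$ to the unique point of $\bigcap_n w_{\sigma_1}\circ\cdots\circ w_{\sigma_n}(K)$. $C(K)$ is embedded in $C(\Sigma_\infty)$ by $f\mapsto f\circ P$, and $C(\Sigma_\infty)=(\mathbb C^3)^{\otimes\infty}$ is embedded in $\mathrm{UHF}(3^\infty)$ as the closure of the union of the diagonal subalgebras of the $M_3(\mathbb C)^{\otimes n}$ (the indicator function of the cylinder of words beginning with $\sigma_1\cdots\sigma_n$ corresponds to $e_{\sigma_1\sigma_1}\otimes\cdots\otimes e_{\sigma_n\sigma_n}$). *)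

theory Defs
  imports "HOL-Analysis.Analysis"
begin

class cstar_algebra = real_normed_algebra_1 + banach +
  fixes scaleC :: "complex \<Rightarrow> 'a \<Rightarrow> 'a"
    and star :: "'a \<Rightarrow> 'a"
  assumes scaleC_add_right: "scaleC c (x + y) = scaleC c x + scaleC c y"
    and scaleC_add_left: "scaleC (c + d) x = scaleC c x + scaleC d x"
    and scaleC_scaleC: "scaleC c (scaleC d x) = scaleC (c * d) x"
    and scaleC_of_real: "scaleC (complex_of_real r) x = scaleR r x"
    and mult_scaleC_left: "scaleC c x * y = scaleC c (x * y)"
    and mult_scaleC_right: "x * scaleC c y = scaleC c (x * y)"
    and norm_scaleC: "norm (scaleC c x) = cmod c * norm x"
    and star_star: "star (star x) = x"
    and star_add: "star (x + y) = star x + star y"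
    and star_scaleC: "star (scaleC c x) = scaleC (cnj c) (star x)"
    and star_mult: "star (x * y) = star y * star x"
    and cstar_identity: "norm (star x * x) = (norm x)\<^sup>2"

global_interpretation complex_vector:
  vector_space "scaleC :: complex \<Rightarrow> 'a \<Rightarrow> 'a::cstar_algebra"
proof
  show "scaleC 1 x = x" for x :: 'a
    using scaleC_of_real[of 1 x] by simp
qed (simp_all add: scaleC_add_right scaleC_add_left scaleC_scaleC)

text \<open>Completeness of the subalgebra is expressed by closedness in the (complete) ambient
  algebra. The unit of the ambient algebra is not required to belong to it.\<close>

definition cstar_subalgebra :: "'a::cstar_algebra set \<Rightarrow> bool" where
  "cstar_subalgebra S \<longleftrightarrow>
     complex_vector.subspace S \<and>
     (\<forall>a\<in>S. \<forall>b\<in>S. a * b \<in> S) \<and>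
     (\<forall>a\<in>S. star a \<in> S) \<and>
     closed S"

text \<open>An isometric *-homomorphism defined on a *-algebra \<open>F\<close> of bounded functions, where
  functions are identified when they agree on \<open>X\<close> and \<open>F\<close> carries the supremum norm over \<open>X\<close>.\<close>

definition isometric_star_hom ::
  "'x set \<Rightarrow> ('x \<Rightarrow> complex) set \<Rightarrow> (('x \<Rightarrow> complex) \<Rightarrow> 'a::cstar_algebra) \<Rightarrow> bool" where
  "isometric_star_hom X F h \<longleftrightarrow>
     (\<forall>f\<in>F. \<forall>g\<in>F. h (\<lambda>x. f x + g x) = h f + h g) \<and>
     (\<forall>f\<in>F. \<forall>c. h (\<lambda>x. c * f x) = scaleC c (h f)) \<and>
     (\<forall>f\<in>F. \<forall>g\<in>F. h (\<lambda>x. f x * g x) = h f * h g) \<and>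
     (\<forall>f\<in>F. h (\<lambda>x. cnj (f x)) = star (h f)) \<and>
     (\<forall>f\<in>F. norm (h f) = (SUP x\<in>X. cmod (f x)))"

text \<open>Indices live in the numeral type \<open>3\<close>, whose arithmetic is modulo 3; in particular
  \<open>3 = 0\<close> there. An element of the \<open>n\<close>-th tensor power of the 3 by 3 matrices is a matrix
  whose rows and columns are indexed by the words of length \<open>n\<close>, extended by \<open>0\<close> to all words.\<close>

type_synonym word_matrix = "3 list \<Rightarrow> 3 list \<Rightarrow> complex"

definition tensor_algebra :: "nat \<Rightarrow> word_matrix set" where
  "tensor_algebra n = {x. \<forall>s t. x s t \<noteq> 0 \<longrightarrow> length s = n \<and> length t = n}"

definition mat_unit :: "3 list \<Rightarrow> 3 list \<Rightarrow> word_matrix" where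
  "mat_unit s t = (\<lambda>s' t'. if s' = s \<and> t' = t then 1 else 0)"

abbreviation e_unit :: "3 \<Rightarrow> 3 \<Rightarrow> word_matrix" where
  "e_unit i j \<equiv> mat_unit [i] [j]"

definition mat_one :: "nat \<Rightarrow> word_matrix" where
  "mat_one n = (\<lambda>s t. if s = t \<and> length s = n then 1 else 0)"

definition mat_add :: "word_matrix \<Rightarrow> word_matrix \<Rightarrow> word_matrix" where
  "mat_add x y = (\<lambda>s t. x s t + y s t)"

definition mat_scale :: "complex \<Rightarrow> word_matrix \<Rightarrow> word_matrix" where
  "mat_scale c x = (\<lambda>s t. c * x s t)"

definition mat_mult :: "nat \<Rightarrow> word_matrix \<Rightarrow> word_matrix \<Rightarrow> word_matrix" where
  "mat_mult n x y = (\<lambda>s t. \<Sum>u | length u = n. x s u * y u t)"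

definition mat_adjoint :: "word_matrix \<Rightarrow> word_matrix" where
  "mat_adjoint x = (\<lambda>s t. cnj (x t s))"

text \<open>The Kronecker product; \<open>n\<close> is the level of the left factor.\<close>

definition tensor :: "nat \<Rightarrow> word_matrix \<Rightarrow> word_matrix \<Rightarrow> word_matrix" where
  "tensor n x y = (\<lambda>s t. x (take n s) (take n t) * y (drop n s) (drop n t))"

text \<open>Tensor powers of a single 3 by 3 matrix (an element of level 1).\<close>

primrec tensor_power :: "word_matrix \<Rightarrow> nat \<Rightarrow> word_matrix" where
  "tensor_power x 0 = mat_one 0"
| "tensor_power x (Suc n) = tensor 1 x (tensor_power x n)"

definition diagonal_algebra :: "nat \<Rightarrow> word_matrix set" where
  "diagonal_algebra n = {x \<in> tensor_algebra n. \<forall>s t. s \<noteq> t \<longrightarrow> x s t = 0}"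

text \<open>The ambient type, together with the maps \<open>\<phi> n\<close>, is the C*-inductive limit of the tensor
  powers under tensoring with the identity on the right. An injective *-homomorphism from a
  matrix algebra to a C*-algebra is isometric, so these conditions determine the limit up to an
  isomorphism commuting with the embeddings.\<close>

locale uhf3 =
  fixes \<phi> :: "nat \<Rightarrow> word_matrix \<Rightarrow> 'a::cstar_algebra"
  assumes add: "\<lbrakk>x \<in> tensor_algebra n; y \<in> tensor_algebra n\<rbrakk> \<Longrightarrow>
      \<phi> n (mat_add x y) = \<phi> n x + \<phi> n y"
    and scale: "x \<in> tensor_algebra n \<Longrightarrow> \<phi> n (mat_scale c x) = scaleC c (\<phi> n x)"
    and mult: "\<lbrakk>x \<in> tensor_algebra n; y \<in> tensor_algebra n\<rbrakk> \<Longrightarrow>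
      \<phi> n (mat_mult n x y) = \<phi> n x * \<phi> n y"
    and adjoint: "x \<in> tensor_algebra n \<Longrightarrow> \<phi> n (mat_adjoint x) = star (\<phi> n x)"
    and one: "\<phi> n (mat_one n) = 1"
    and inj: "inj_on (\<phi> n) (tensor_algebra n)"
    and compatible: "x \<in> tensor_algebra n \<Longrightarrow> \<phi> (Suc n) (tensor n x (mat_one 1)) = \<phi> n x"
    and dense: "closure (\<Union>n. \<phi> n ` tensor_algebra n) = UNIV"

definition alpha :: "nat \<Rightarrow> 3 \<Rightarrow> word_matrix" where
  "alpha n j = tensor 1 (e_unit j j) (tensor_power (e_unit 2 2) n)"

definition beta :: "nat \<Rightarrow> 3 \<Rightarrow> word_matrix" where
  "beta k j = tensor 2
     (mat_add (tensor 1 (e_unit j j) (e_unit 1 1)) (tensor 1 (e_unit (j + 2) (j + 2)) (e_unit 3 3)))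
     (tensor_power (e_unit 2 2) (k - 1))"

definition A_level :: "(nat \<Rightarrow> word_matrix \<Rightarrow> 'a::cstar_algebra) \<Rightarrow> nat \<Rightarrow> 'a set" where
  "A_level \<phi> n = complex_vector.span (\<phi> (n + 1) `
     (range (alpha n) \<union>
      {tensor (n - k) x (beta k j) | k j x. k \<in> {1..n} \<and> x \<in> tensor_algebra (n - k)}))"

definition A_infinity :: "(nat \<Rightarrow> word_matrix \<Rightarrow> 'a::cstar_algebra) \<Rightarrow> 'a set" where
  "A_infinity \<phi> = {a. \<exists>s. (\<forall>n. s n \<in> A_level \<phi> n) \<and> s \<longlonglongrightarrow> a}"

definition cantor_space :: "(nat \<Rightarrow> 3) topology" where
  "cantor_space = product_topology (\<lambda>_. discrete_topology UNIV) UNIV"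

definition C_cantor :: "((nat \<Rightarrow> 3) \<Rightarrow> complex) set" where
  "C_cantor = {f. continuous_map cantor_space euclidean f}"

text \<open>Sequences are indexed from \<open>0\<close>, so the first letter of \<open>\<sigma>\<close> is \<open>\<sigma> 0\<close>.\<close>

definition prefix_word :: "(nat \<Rightarrow> 3) \<Rightarrow> nat \<Rightarrow> 3 list" where
  "prefix_word \<sigma> n = map \<sigma> [0..<n]"

definition cylinder :: "3 list \<Rightarrow> (nat \<Rightarrow> 3) set" where
  "cylinder s = {\<sigma>. prefix_word \<sigma> (length s) = s}"

definition is_cantor_embedding ::
  "(nat \<Rightarrow> word_matrix \<Rightarrow> 'a::cstar_algebra) \<Rightarrow> (((nat \<Rightarrow> 3) \<Rightarrow> complex) \<Rightarrow> 'a) \<Rightarrow> bool" where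
  "is_cantor_embedding \<phi> \<iota> \<longleftrightarrow>
     isometric_star_hom UNIV C_cantor \<iota> \<and>
     \<iota> ` C_cantor = closure (\<Union>n. \<phi> n ` diagonal_algebra n) \<and>
     (\<forall>s. \<iota> (indicator (cylinder s)) = \<phi> (length s) (mat_unit s s))"

text \<open>The embedding is unique on \<open>C_cantor\<close>, since the indicators of cylinders span a dense
  subspace there; its values elsewhere are irrelevant.\<close>

definition cantor_embedding ::
  "(nat \<Rightarrow> word_matrix \<Rightarrow> 'a::cstar_algebra) \<Rightarrow> ((nat \<Rightarrow> 3) \<Rightarrow> complex) \<Rightarrow> 'a" where
  "cantor_embedding \<phi> = (SOME \<iota>. is_cantor_embedding \<phi> \<iota>)"

locale sierpinski_gasket =
  fixes v :: "3 \<Rightarrow> real^2" and w :: "3 \<Rightarrow> real^2 \<Rightarrow> real^2" and K :: "(real^2) set"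
  assumes equilateral: "\<exists>d>0. \<forall>i j. i \<noteq> j \<longrightarrow> dist (v i) (v j) = d"
    and affine_map: "linear (\<lambda>x. w j x - w j 0)"
    and ratio: "dist (w j x) (w j y) = 1 / 2 * dist x y"
    and w_v2: "w j (v 2) = v j"
    and w_v3: "w j (v 3) = midpoint (v j) (v (j + 1))"
    and w_v1: "w j (v 1) = midpoint (v j) (v (j - 1))"
    and nonempty: "K \<noteq> {}"
    and compact: "compact K"
    and self_similar: "K = (\<Union>j. w j ` K)"

text \<open>The map \<open>P\<close>; note that \<open>foldr w [j\<^sub>1, \<dots>, j\<^sub>n]\<close> is the composition \<open>w j\<^sub>1 \<circ> \<dots> \<circ> w j\<^sub>n\<close>.\<close>

definition coding_map ::
  "(3 \<Rightarrow> real^2 \<Rightarrow> real^2) \<Rightarrow> (real^2) set \<Rightarrow> (nat \<Rightarrow> 3) \<Rightarrow> real^2" where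
  "coding_map w K \<sigma> = (THE x. x \<in> (\<Inter>n. foldr w (prefix_word \<sigma> n) ` K))"

definition gasket_embedding ::
  "(nat \<Rightarrow> word_matrix \<Rightarrow> 'a::cstar_algebra) \<Rightarrow> (3 \<Rightarrow> real^2 \<Rightarrow> real^2) \<Rightarrow> (real^2) set \<Rightarrow>
     (real^2 \<Rightarrow> complex) \<Rightarrow> 'a" where
  "gasket_embedding \<phi> w K f = cantor_embedding \<phi> (f \<circ> coding_map w K)"

end

theory Submission
  imports Defs
begin

text \<open>Each \<open>A_level \<phi> n\<close> is a *-algebra: its generators have the form \<open>x \<otimes> p\<close> with \<open>p\<close> a
  diagonal projection, and the projections \<open>\<alpha>\<^sup>n_j\<close>, \<open>1 \<otimes> \<beta>\<^sup>k_j\<close> are mutually orthogonal. The limits of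
  sequences drawn from *-algebras form a closed *-algebra. For \<open>f\<close> in \<open>C(K)\<close>, approximate \<open>f \<circ> P\<close>
  at level \<open>n + 1\<close> by its values at the sequences \<open>s 2 2 2 \<dots>\<close> with \<open>s\<close> of length \<open>n + 1\<close>; since
  \<open>P (t j 1 2 2 \<dots>) = P (t (j + 2) 3 2 2 \<dots>)\<close>, the resulting diagonal matrix is constant on the
  supports of the \<open>\<beta>\<^sup>k_j\<close>, so it lies in \<open>A_level \<phi> n\<close>, and uniform continuity gives convergence.\<close>

section \<open>Limits of sequences of subspaces\<close>

text \<open>The spaces \<open>A_level \<phi> n\<close> do not increase with n: for instance e_11
  \<otimes> 1 is not in the span at n = 1, where e_11 \<otimes> e_11 occurs only together with e_33
  \<otimes> e_33. So \<open>A_infinity\<close> is not the closure of an increasing union, and its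
  closedness needs an argument of its own.

  The second obstacle is the norm. The ambient algebra is abstract, so the fact that diagonal
  matrices carry the maximum norm has to be extracted from the C*-identity and the injectivity of
  the maps \<open>\<phi> n\<close>. This norm formula makes it possible to construct an embedding of
  \<open>C_cantor\<close>, which shows that the choice in \<open>cantor_embedding\<close> has a
  witness. Afterwards only the properties listed in \<open>is_cantor_embedding\<close> are available
  for the chosen map.

  The pairing in \<beta> is geometric: a word s, padded by 2s, codes the corner
  \<open>foldr w s (v 2)\<close> of a cell, and the two words of a \<beta> code a corner shared by
  two neighbouring cells.\<close>

lemma star_zero [simp]: "star 0 = (0 :: 'a::cstar_algebra)"
  using star_scaleC[of 0 "0 :: 'a"] by simp

lemma star_diff: "star (x - y) = star x - star (y :: 'a::cstar_algebra)"
proof -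
  have "star x = star (x - y) + star y"
    unfolding star_add[symmetric] by simp
  then show ?thesis by simp
qed

text \<open>The C*-identity and submultiplicativity give \<open>norm y \<le> norm (star y)\<close>
  for every y; taking \<open>star x\<close> for y gives the converse.\<close>

lemma norm_star [simp]: "norm (star x) = norm (x :: 'a::cstar_algebra)"
proof -
  have "norm y \<le> norm (star y)" for y :: 'a
  proof (cases "y = 0")
    case False
    have "norm y * norm y \<le> norm (star y) * norm y"
      by (metis cstar_identity norm_mult_ineq power2_eq_square)
    with False show ?thesis by simp
  qed simp
  from this[of x] this[of "star x"] show ?thesis by (simp add: star_star)
qed

lemma tendsto_star: "s \<longlonglongrightarrow> a \<Longrightarrow> (\<lambda>n. star (s n)) \<longlonglongrightarrow> star (a :: 'a::cstar_algebra)"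
  by (simp add: tendsto_iff dist_norm flip: star_diff)

lemma tendsto_scaleC: "s \<longlonglongrightarrow> a \<Longrightarrow> (\<lambda>n. scaleC c (s n)) \<longlonglongrightarrow> scaleC c (a :: 'a::cstar_algebra)"
proof -
  assume "s \<longlonglongrightarrow> a"
  then have "(\<lambda>n. cmod c * norm (s n - a)) \<longlonglongrightarrow> cmod c * 0"
    by (intro tendsto_mult tendsto_const) (simp add: LIM_zero tendsto_norm_zero)
  then have "(\<lambda>n. norm (scaleC c (s n) - scaleC c a)) \<longlonglongrightarrow> 0"
    by (simp add: norm_scaleC flip: complex_vector.scale_right_diff_distrib)
  then show ?thesis
    by (simp add: LIM_zero_cancel tendsto_norm_zero_iff)
qed

text \<open>In terms of distances it becomes visible that the set of limits is closed, although the \<open>S n\<close>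
  need not be nested.\<close>

lemma limit_set_iff_infdist:
  fixes S :: "nat \<Rightarrow> 'a::metric_space set"
  assumes ne: "\<And>n. S n \<noteq> {}"
  shows "(\<exists>s. (\<forall>n. s n \<in> S n) \<and> s \<longlonglongrightarrow> a) \<longleftrightarrow> (\<lambda>n. infdist a (S n)) \<longlonglongrightarrow> 0"
proof
  assume "\<exists>s. (\<forall>n. s n \<in> S n) \<and> s \<longlonglongrightarrow> a"
  then obtain s where s: "\<And>n. s n \<in> S n" "s \<longlonglongrightarrow> a" by blast
  have "(\<lambda>n. dist a (s n)) \<longlonglongrightarrow> 0"
    using s(2) by (simp add: tendsto_dist_iff[of s] dist_commute)
  then show "(\<lambda>n. infdist a (S n)) \<longlonglongrightarrow> 0"
    by (rule tendsto_sandwich[rotated 3])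
      (auto intro!: always_eventually infdist_nonneg infdist_le s)
next
  assume lim: "(\<lambda>n. infdist a (S n)) \<longlonglongrightarrow> 0"
  \<comment> \<open>The infimum need not be attained; the slack \<open>inverse (Suc n)\<close> makes
    room for a near-minimiser and vanishes in the limit.\<close>
  have "\<exists>x\<in>S n. dist a x < infdist a (S n) + inverse (real (Suc n))" for n
  proof (rule ccontr)
    assume "\<not> ?thesis"
    then have "infdist a (S n) + inverse (real (Suc n)) \<le> (INF x\<in>S n. dist a x)"
      by (intro cINF_greatest ne) (auto simp: not_less)
    also have "\<dots> = infdist a (S n)" by (simp add: infdist_notempty ne)
    finally have "inverse (real (Suc n)) \<le> 0" by simp
    then show False by (simp add: field_simps)
  qed
  then obtain s where s: "\<And>n. s n \<in> S n"
      "\<And>n. dist a (s n) < infdist a (S n) + inverse (real (Suc n))"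
    by metis
  have "(\<lambda>n. infdist a (S n) + inverse (real (Suc n))) \<longlonglongrightarrow> 0"
    using tendsto_add[OF lim LIMSEQ_inverse_real_of_nat] by simp
  moreover have "\<forall>n\<ge>0. norm (dist a (s n)) \<le> infdist a (S n) + inverse (real (Suc n))"
    using less_imp_le[OF s(2)] by simp
  ultimately have "(\<lambda>n. dist a (s n)) \<longlonglongrightarrow> 0"
    using Lim_null_comparison eventually_sequentially by blast
  then have "s \<longlonglongrightarrow> a"
    unfolding tendsto_dist_iff[of s] by (simp add: dist_commute)
  with s(1) show "\<exists>s. (\<forall>n. s n \<in> S n) \<and> s \<longlonglongrightarrow> a"
    by blast
qed

text \<open>\<open>infdist\<close> is 1-Lipschitz in its point, so the condition that the distances
  to the \<open>S n\<close> tend to 0 survives a limit in that point.\<close>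

lemma closed_limit_set:
  fixes S :: "nat \<Rightarrow> 'a::metric_space set"
  assumes ne: "\<And>n. S n \<noteq> {}"
  shows "closed {a. \<exists>s. (\<forall>n. s n \<in> S n) \<and> s \<longlonglongrightarrow> a}"
  unfolding limit_set_iff_infdist[OF ne] closed_sequential_limits
proof safe
  fix b a
  assume b: "\<forall>k. b k \<in> {a. (\<lambda>n. infdist a (S n)) \<longlonglongrightarrow> 0}" and "b \<longlonglongrightarrow> a"
  show "(\<lambda>n. infdist a (S n)) \<longlonglongrightarrow> 0"
  proof (rule tendstoI)
    fix e :: real assume "e > 0"
    then obtain k where k: "dist (b k) a < e / 2"
      using \<open>b \<longlonglongrightarrow> a\<close> by (metis half_gt_zero lim_sequentially order_refl)
    have "\<forall>\<^sub>F n in sequentially. dist (infdist (b k) (S n)) 0 < e / 2"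
      using b \<open>e > 0\<close> by (intro tendstoD[of _ 0]) auto
    then show "\<forall>\<^sub>F n in sequentially. dist (infdist a (S n)) 0 < e"
    proof eventually_elim
      case (elim n)
      then show ?case
        using k infdist_triangle[of a "S n" "b k"] infdist_nonneg[of a "S n"]
        by (simp add: dist_commute infdist_nonneg)
    qed
  qed
qed

lemma cstar_subalgebra_limit_set:
  fixes S :: "nat \<Rightarrow> 'a::cstar_algebra set"
  assumes sub: "\<And>n. complex_vector.subspace (S n)"
    and mult: "\<And>n a b. a \<in> S n \<Longrightarrow> b \<in> S n \<Longrightarrow> a * b \<in> S n"
    and star: "\<And>n a. a \<in> S n \<Longrightarrow> star a \<in> S n"
  shows "cstar_subalgebra {a. \<exists>s. (\<forall>n. s n \<in> S n) \<and> s \<longlonglongrightarrow> a}" (is "cstar_subalgebra ?L")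
  unfolding cstar_subalgebra_def
proof (intro conjI ballI)
  have LI: "a \<in> ?L" if "\<And>n. s n \<in> S n" "s \<longlonglongrightarrow> a" for s a
    using that by blast
  show "complex_vector.subspace ?L"
    unfolding complex_vector.subspace_def
  proof (intro conjI ballI allI)
    show "0 \<in> ?L"
      by (rule LI[OF complex_vector.subspace_0[OF sub]]) simp
    fix x y c
    assume "x \<in> ?L"
    then obtain s where s: "\<And>n. s n \<in> S n" "s \<longlonglongrightarrow> x" by blast
    show "scaleC c x \<in> ?L"
      by (rule LI[OF complex_vector.subspace_scale[OF sub s(1)] tendsto_scaleC[OF s(2)]])
    assume "y \<in> ?L"
    then obtain t where t: "\<And>n. t n \<in> S n" "t \<longlonglongrightarrow> y" by blast
    show "x + y \<in> ?L"
      by (rule LI[OF complex_vector.subspace_add[OF sub s(1) t(1)] tendsto_add[OF s(2) t(2)]])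
  qed
  fix x y
  assume "x \<in> ?L"
  then obtain s where s: "\<And>n. s n \<in> S n" "s \<longlonglongrightarrow> x" by blast
  show "star x \<in> ?L"
    by (rule LI[OF star[OF s(1)] tendsto_star[OF s(2)]])
  assume "y \<in> ?L"
  then obtain t where t: "\<And>n. t n \<in> S n" "t \<longlonglongrightarrow> y" by blast
  show "x * y \<in> ?L"
    by (rule LI[OF mult[OF s(1) t(1)] tendsto_mult[OF s(2) t(2)]])
next
  show "closed ?L"
    by (rule closed_limit_set) (use complex_vector.subspace_0[OF sub] in blast)
qed

text \<open>By bilinearity products of generators suffice. They are only required to lie in the
  span, because a product of two generators may vanish.\<close>

lemma span_mult_closed:
  fixes G :: "'a::cstar_algebra set"
  assumes G: "\<And>p q. p \<in> G \<Longrightarrow> q \<in> G \<Longrightarrow> p * q \<in> complex_vector.span G"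
    and a: "a \<in> complex_vector.span G" and b: "b \<in> complex_vector.span G"
  shows "a * b \<in> complex_vector.span G"
proof -
  have "p * b \<in> complex_vector.span G" if p: "p \<in> G" for p
    using b
  proof (induction rule: complex_vector.span_induct_alt)
    case base show ?case by (simp add: complex_vector.span_zero)
  next
    case (step c x y)
    then show ?case
      using G[OF p, of x]
      by (simp add: distrib_left mult_scaleC_right complex_vector.span_add complex_vector.span_scale)
  qed
  with a show ?thesis
  proof (induction rule: complex_vector.span_induct_alt)
    case base show ?case by (simp add: complex_vector.span_zero)
  next
    case (step c x y)
    then show ?case
      by (simp add: distrib_right mult_scaleC_left complex_vector.span_add complex_vector.span_scale)
  qed
qed

lemma span_star_closed:
  fixes G :: "'a::cstar_algebra set"
  assumes G: "\<And>p. p \<in> G \<Longrightarrow> star p \<in> complex_vector.span G"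
    and a: "a \<in> complex_vector.span G"
  shows "star a \<in> complex_vector.span G"
  using a
proof (induction rule: complex_vector.span_induct_alt)
  case base
  show ?case by (simp add: complex_vector.span_zero)
next
  case (step c x y)
  then show ?case
    by (simp add: star_add star_scaleC G complex_vector.span_add complex_vector.span_scale)
qed

section \<open>The algebras of matrices indexed by words\<close>

definition word_proj :: "3 list set \<Rightarrow> word_matrix" where
  "word_proj W = (\<lambda>s t. if s = t \<and> s \<in> W then 1 else 0)"

text \<open>Continued by 2s, the two words are two addresses of one point of the gasket, the
  midpoint of \<open>v j\<close> and \<open>v (j + 2)\<close>.\<close>

definition beta_words :: "nat \<Rightarrow> 3 \<Rightarrow> 3 list set" where
  "beta_words k j = {j # 1 # replicate (k - 1) 2, (j + 2) # 3 # replicate (k - 1) 2}"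

text \<open>The first letter is skipped: this tells the summands of \<open>A_level\<close> apart, the value being
  \<open>n\<close> on the support of \<open>alpha n j\<close> and \<open>k - 1\<close> on that of \<open>tensor (n - k) x (beta k j)\<close>.\<close>

definition trailing_twos :: "3 list \<Rightarrow> nat" where
  "trailing_twos s = length (takeWhile ((=) 2) (rev (tl s)))"

lemma finite_words [simp]: "finite {u :: 3 list. length u = n}"
  using finite_lists_length_eq[of "UNIV :: 3 set" n] by simp

lemma tensor_algebraI:
  "(\<And>s t. x s t \<noteq> 0 \<Longrightarrow> length s = n \<and> length t = n) \<Longrightarrow> x \<in> tensor_algebra n"
  by (simp add: tensor_algebra_def)

lemma tensor_algebraD:
  "x \<in> tensor_algebra n \<Longrightarrow> x s t \<noteq> 0 \<Longrightarrow> length s = n \<and> length t = n"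
  by (simp add: tensor_algebra_def)

lemma zero_in_tensor_algebra [simp]: "(\<lambda>_ _. 0) \<in> tensor_algebra n"
  by (simp add: tensor_algebra_def)

lemma sum_in_tensor_algebra:
  assumes "\<And>i. i \<in> I \<Longrightarrow> x i \<in> tensor_algebra n"
  shows "(\<lambda>s t. \<Sum>i\<in>I. x i s t) \<in> tensor_algebra n"
proof (rule tensor_algebraI)
  fix s t assume "(\<Sum>i\<in>I. x i s t) \<noteq> 0"
  then obtain i where "i \<in> I" "x i s t \<noteq> 0"
    by (meson sum.neutral)
  with assms show "length s = n \<and> length t = n"
    by (blast dest: tensor_algebraD)
qed

lemma mat_unit_in_tensor_algebra: "length s = n \<Longrightarrow> length t = n \<Longrightarrow> mat_unit s t \<in> tensor_algebra n"
  by (auto simp: tensor_algebra_def mat_unit_def)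

lemma word_proj_in_tensor_algebra: "(\<And>s. s \<in> W \<Longrightarrow> length s = n) \<Longrightarrow> word_proj W \<in> tensor_algebra n"
  by (auto simp: tensor_algebra_def word_proj_def split: if_splits)

lemma mat_mult_in_tensor_algebra:
  assumes "x \<in> tensor_algebra n" "y \<in> tensor_algebra n"
  shows "mat_mult n x y \<in> tensor_algebra n"
proof (rule tensor_algebraI)
  fix s t assume "mat_mult n x y s t \<noteq> 0"
  then obtain u where "x s u * y u t \<noteq> 0"
    unfolding mat_mult_def by (meson sum.neutral)
  then show "length s = n \<and> length t = n"
    using assms by (auto dest: tensor_algebraD)
qed

lemma mat_adjoint_in_tensor_algebra:
  "x \<in> tensor_algebra n \<Longrightarrow> mat_adjoint x \<in> tensor_algebra n"
  by (auto simp: tensor_algebra_def mat_adjoint_def)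

lemma tensor_in_tensor_algebra:
  assumes "x \<in> tensor_algebra m" "y \<in> tensor_algebra l"
  shows "tensor m x y \<in> tensor_algebra (m + l)"
proof (rule tensor_algebraI)
  fix s t assume "tensor m x y s t \<noteq> 0"
  then have "x (take m s) (take m t) \<noteq> 0" "y (drop m s) (drop m t) \<noteq> 0"
    by (auto simp: tensor_def)
  then have "length (take m s) = m" "length (take m t) = m" "length (drop m s) = l" "length (drop m t) = l"
    using assms by (auto dest: tensor_algebraD simp del: length_take length_drop)
  then show "length s = m + l \<and> length t = m + l"
    by (metis append_take_drop_id length_append)
qed

text \<open>Cutting after m letters is a bijection from words of length m + l to pairs of words, so
  the sum over inner words factors.\<close>

lemma mat_mult_tensor:
  "mat_mult (m + l) (tensor m x y) (tensor m x' y') = tensor m (mat_mult m x x') (mat_mult l y y')"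
proof (intro ext)
  fix s t
  let ?f = "\<lambda>a b. x (take m s) a * y (drop m s) b * (x' a (take m t) * y' b (drop m t))"
  have "mat_mult (m + l) (tensor m x y) (tensor m x' y') s t
      = (\<Sum>u | length u = m + l. ?f (take m u) (drop m u))"
    by (simp add: mat_mult_def tensor_def)
  also have "\<dots> = (\<Sum>(a, b)\<in>{u. length u = m} \<times> {u. length u = l}. ?f a b)"
    by (rule sum.reindex_bij_witness[of _ "\<lambda>(a, b). a @ b" "\<lambda>u. (take m u, drop m u)"]) auto
  also have "\<dots> = (\<Sum>a | length a = m. \<Sum>b | length b = l.
      (x (take m s) a * x' a (take m t)) * (y (drop m s) b * y' b (drop m t)))"
    by (subst sum.cartesian_product[symmetric]) (simp add: mult_ac)
  also have "\<dots> = tensor m (mat_mult m x x') (mat_mult l y y') s t"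
    by (simp add: tensor_def mat_mult_def sum_product)
  finally show "mat_mult (m + l) (tensor m x y) (tensor m x' y') s t
    = tensor m (mat_mult m x x') (mat_mult l y y') s t" .
qed

lemma tensor_mat_unit:
  assumes "length s = m" "length t = m"
  shows "tensor m (mat_unit s t) (mat_unit s' t') = mat_unit (s @ s') (t @ t')"
proof (intro ext)
  fix u w
  have "take m u = s \<and> drop m u = s' \<longleftrightarrow> u = s @ s'" "take m w = t \<and> drop m w = t' \<longleftrightarrow> w = t @ t'"
    using assms by (metis append_eq_conv_conj)+
  then show "tensor m (mat_unit s t) (mat_unit s' t') u w = mat_unit (s @ s') (t @ t') u w"
    by (auto simp: tensor_def mat_unit_def)
qed

lemma tensor_mat_add_left: "tensor m (mat_add x x') y = mat_add (tensor m x y) (tensor m x' y)"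
  by (simp add: tensor_def mat_add_def fun_eq_iff algebra_simps)

lemma tensor_zero_right: "tensor m x (\<lambda>_ _. 0) = (\<lambda>_ _. 0)"
  by (simp add: tensor_def)

lemma mat_adjoint_tensor: "mat_adjoint (tensor m x y) = tensor m (mat_adjoint x) (mat_adjoint y)"
  by (simp add: tensor_def mat_adjoint_def fun_eq_iff)

lemma tensor_power_mat_unit:
  "tensor_power (e_unit i i) n = mat_unit (replicate n i) (replicate n i)"
proof (induction n)
  case 0
  show ?case by (auto simp: mat_one_def mat_unit_def fun_eq_iff)
next
  case (Suc n)
  then show ?case by (simp add: tensor_mat_unit)
qed

lemma mat_unit_eq_word_proj: "mat_unit s s = word_proj {s}"
  by (auto simp: mat_unit_def word_proj_def fun_eq_iff)

lemma alpha_eq: "alpha n j = word_proj {j # replicate n 2}"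
  by (simp add: alpha_def tensor_power_mat_unit tensor_mat_unit flip: mat_unit_eq_word_proj)

lemma beta_eq: "beta k j = word_proj (beta_words k j)"
proof -
  have "beta k j = mat_add (mat_unit (j # 1 # replicate (k - 1) 2) (j # 1 # replicate (k - 1) 2))
     (mat_unit ((j + 2) # 3 # replicate (k - 1) 2) ((j + 2) # 3 # replicate (k - 1) 2))"
    by (simp add: beta_def tensor_power_mat_unit tensor_mat_add_left tensor_mat_unit)
  then show ?thesis
    by (auto simp: mat_add_def mat_unit_def word_proj_def beta_words_def fun_eq_iff)
qed

lemma mat_mult_word_proj:
  assumes "\<And>s. s \<in> W \<Longrightarrow> length s = n"
  shows "mat_mult n (word_proj W) (word_proj W') = word_proj (W \<inter> W')"
proof (intro ext)
  fix s t
  have "mat_mult n (word_proj W) (word_proj W') s t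
      = (\<Sum>u | length u = n. if u = s then (if s \<in> W \<and> s = t \<and> s \<in> W' then 1 else 0) else 0)"
    unfolding mat_mult_def by (intro sum.cong) (auto simp: word_proj_def)
  also have "\<dots> = word_proj (W \<inter> W') s t"
    using assms by (subst sum.delta) (auto simp: word_proj_def)
  finally show "mat_mult n (word_proj W) (word_proj W') s t = word_proj (W \<inter> W') s t" .
qed

lemma mat_adjoint_word_proj: "mat_adjoint (word_proj W) = word_proj W"
  by (auto simp: mat_adjoint_def word_proj_def fun_eq_iff)

lemma word_proj_empty: "word_proj {} = (\<lambda>_ _. 0)"
  by (simp add: word_proj_def)

lemma length_beta_words: "k \<ge> 1 \<Longrightarrow> s \<in> beta_words k j \<Longrightarrow> length s = Suc k"
  by (auto simp: beta_words_def)

text \<open>The second letter, 1 or 3, tells the two members apart; once it is known, the first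
  letter recovers j.\<close>

lemma beta_words_disjoint: "i \<noteq> j \<Longrightarrow> beta_words k i \<inter> beta_words k j = {}"
  by (auto simp: beta_words_def)

lemma trailing_twos_alpha: "trailing_twos (j # replicate n 2) = n"
  by (simp add: trailing_twos_def)

lemma trailing_twos_beta:
  assumes "k \<ge> 1" "drop m s \<in> beta_words k j"
  shows "trailing_twos s = k - 1"
proof -
  obtain i l where il: "l \<noteq> 2" "drop m s = i # l # replicate (k - 1) 2"
    using assms(2) by (auto simp: beta_words_def)
  have "s = take m s @ i # l # replicate (k - 1) 2"
    by (metis append_take_drop_id il(2))
  \<comment> \<open>The letter i is grouped with the prefix so that \<open>tl\<close> acts on a
    nonempty list even when m = 0.\<close>
  then have "tl s = tl (take m s @ [i]) @ l # replicate (k - 1) 2"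
    by (metis append.assoc append_Cons append_Nil append_is_Nil_conv not_Cons_self2 tl_append2)
  with il(1) show ?thesis
    by (simp add: trailing_twos_def takeWhile_append)
qed

text \<open>A nonzero term would have an inner word u on which f takes both values. With
  \<open>trailing_twos\<close> for f this makes generators with different run lengths
  orthogonal.\<close>

lemma mat_mult_eq_zero:
  assumes "\<And>s u. x s u \<noteq> 0 \<Longrightarrow> f u = a" "\<And>u t. y u t \<noteq> 0 \<Longrightarrow> f u = b" "a \<noteq> b"
  shows "mat_mult n x y = (\<lambda>_ _. 0)"
  unfolding mat_mult_def using assms by (intro ext sum.neutral) fastforce

section \<open>The generators at the level of matrices and their products\<close>

definition A_gens :: "nat \<Rightarrow> word_matrix set" where
  "A_gens n = range (alpha n) \<union>
      {tensor (n - k) x (beta k j) | k j x. k \<in> {1..n} \<and> x \<in> tensor_algebra (n - k)}"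

lemma A_gens_cases:
  assumes "p \<in> A_gens n"
  obtains (alpha) j where "p = word_proj {j # replicate n 2}"
  | (beta) k j x where "k \<in> {1..n}" "x \<in> tensor_algebra (n - k)"
      "p = tensor (n - k) x (word_proj (beta_words k j))"
  using assms unfolding A_gens_def alpha_eq beta_eq by blast

lemma alpha_in_A_gens: "word_proj {j # replicate n 2} \<in> A_gens n"
  unfolding A_gens_def alpha_eq by blast

lemma beta_in_A_gens:
  "k \<in> {1..n} \<Longrightarrow> x \<in> tensor_algebra (n - k) \<Longrightarrow>
    tensor (n - k) x (word_proj (beta_words k j)) \<in> A_gens n"
  unfolding A_gens_def beta_eq by blast

lemma A_gens_in_tensor_algebra:
  assumes "p \<in> A_gens n" shows "p \<in> tensor_algebra (n + 1)"
  using assms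
proof (cases rule: A_gens_cases)
  case (alpha j)
  then show ?thesis by (auto intro!: word_proj_in_tensor_algebra)
next
  case (beta k j x)
  have "tensor (n - k) x (word_proj (beta_words k j)) \<in> tensor_algebra (n - k + Suc k)"
    using beta by (intro tensor_in_tensor_algebra word_proj_in_tensor_algebra) (auto simp: length_beta_words)
  with beta show ?thesis by simp
qed

lemma mat_adjoint_A_gens: "p \<in> A_gens n \<Longrightarrow> mat_adjoint p \<in> A_gens n"
  by (erule A_gens_cases)
    (simp_all add: mat_adjoint_tensor mat_adjoint_word_proj alpha_in_A_gens beta_in_A_gens
      mat_adjoint_in_tensor_algebra)

lemma trailing_twos_tensor_beta:
  assumes "k \<ge> 1" "tensor m x (word_proj (beta_words k j)) s t \<noteq> 0"
  shows "trailing_twos s = k - 1" "trailing_twos t = k - 1"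
proof -
  from assms(2) have "drop m s \<in> beta_words k j" "drop m t \<in> beta_words k j"
    by (auto simp: tensor_def word_proj_def split: if_splits)
  with assms(1) show "trailing_twos s = k - 1" "trailing_twos t = k - 1"
    by (blast intro: trailing_twos_beta)+
qed

text \<open>Generators with different values of \<open>trailing_twos\<close> annihilate each other:
  the value is n for \<alpha> and k - 1 < n for \<beta>, with k determined by the value. For equal k
  the right legs are orthogonal projections, and the left legs multiply. The zero matrix is listed
  separately because at n = 0 it is not itself a generator.\<close>

lemma mat_mult_A_gens:
  assumes p: "p \<in> A_gens n" and q: "q \<in> A_gens n"
  shows "mat_mult (n + 1) p q \<in> insert (\<lambda>_ _. 0) (A_gens n)"
  using p
proof (cases rule: A_gens_cases)
  case p: (alpha i)
  from q show ?thesis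
  proof (cases rule: A_gens_cases)
    case (alpha j)
    have "mat_mult (n + 1) p q = word_proj ({i # replicate n 2} \<inter> {j # replicate n 2})"
      unfolding p alpha by (rule mat_mult_word_proj) auto
    then show ?thesis
      by (cases "i = j") (simp_all add: alpha_in_A_gens word_proj_empty)
  next
    case (beta k j x)
    have "mat_mult (n + 1) p q = (\<lambda>_ _. 0)"
      by (rule mat_mult_eq_zero[where f = trailing_twos and a = n and b = "k - 1"])
        (use p beta in \<open>auto simp: word_proj_def trailing_twos_alpha trailing_twos_tensor_beta split: if_splits\<close>)
    then show ?thesis by simp
  qed
next
  case p: (beta k i x)
  from q show ?thesis
  proof (cases rule: A_gens_cases)
    case (alpha j)
    have "mat_mult (n + 1) p q = (\<lambda>_ _. 0)"
      by (rule mat_mult_eq_zero[where f = trailing_twos and a = "k - 1" and b = n])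
        (use p alpha in \<open>auto simp: word_proj_def trailing_twos_alpha trailing_twos_tensor_beta split: if_splits\<close>)
    then show ?thesis by simp
  next
    case (beta l j y)
    show ?thesis
    proof (cases "k = l")
      case True
      \<comment> \<open>Since k \<le> n, the level n + 1 splits as (n - k) + (k + 1), the form that
        \<open>mat_mult_tensor\<close> expects.\<close>
      have "mat_mult (n + 1) p q = mat_mult (n - k + Suc k) p q"
        using p by simp
      also have "\<dots> = tensor (n - k) (mat_mult (n - k) x y) (word_proj (beta_words k i \<inter> beta_words k j))"
        unfolding p beta \<open>k = l\<close>[symmetric] mat_mult_tensor
        using p by (subst mat_mult_word_proj) (auto simp: length_beta_words)
      finally have "mat_mult (n + 1) p q
        = tensor (n - k) (mat_mult (n - k) x y) (word_proj (beta_words k i \<inter> beta_words k j))" .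
      then show ?thesis
        using p beta True
        by (cases "i = j")
          (simp_all add: beta_words_disjoint beta_in_A_gens mat_mult_in_tensor_algebra word_proj_empty tensor_zero_right)
    next
      case False
      have "mat_mult (n + 1) p q = (\<lambda>_ _. 0)"
        by (rule mat_mult_eq_zero[where f = trailing_twos and a = "k - 1" and b = "l - 1"])
          (use p beta False in \<open>auto simp: trailing_twos_tensor_beta\<close>)
      then show ?thesis by simp
    qed
  qed
qed

lemma A_level_eq: "A_level \<phi> n = complex_vector.span (\<phi> (n + 1) ` A_gens n)"
  by (simp add: A_level_def A_gens_def)

section \<open>Transfer of the generators to the C*-algebra\<close>

context uhf3
begin

lemma phi_zero [simp]: "\<phi> n (\<lambda>_ _. 0) = 0"
  using scale[of "\<lambda>_ _. 0" n 0] by (simp add: mat_scale_def)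

lemma phi_sum:
  assumes "\<And>i. i \<in> I \<Longrightarrow> x i \<in> tensor_algebra n"
  shows "\<phi> n (\<lambda>s t. \<Sum>i\<in>I. x i s t) = (\<Sum>i\<in>I. \<phi> n (x i))"
  using assms
proof (induction I rule: infinite_finite_induct)
  case (insert i I)
  have "(\<lambda>s t. \<Sum>i\<in>I. x i s t) \<in> tensor_algebra n"
    using insert.prems by (intro sum_in_tensor_algebra) simp
  with insert show ?case
    using add[of "x i" n "\<lambda>s t. \<Sum>i\<in>I. x i s t"] by (simp add: mat_add_def)
qed simp_all

lemma cstar_subalgebra_A_infinity: "cstar_subalgebra (A_infinity \<phi>)"
  unfolding A_infinity_def
proof (rule cstar_subalgebra_limit_set)
  fix n
  show "complex_vector.subspace (A_level \<phi> n)"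
    by (simp add: A_level_eq)
  have "\<phi> (n + 1) p * \<phi> (n + 1) q \<in> complex_vector.span (\<phi> (n + 1) ` A_gens n)"
    if "p \<in> A_gens n" "q \<in> A_gens n" for p q
  proof -
    have "\<phi> (n + 1) p * \<phi> (n + 1) q = \<phi> (n + 1) (mat_mult (n + 1) p q)"
      using that by (intro mult[symmetric] A_gens_in_tensor_algebra)
    with mat_mult_A_gens[OF that] show ?thesis
      by (auto intro: complex_vector.span_base complex_vector.span_zero)
  qed
  note mult = this
  show "a * b \<in> A_level \<phi> n" if "a \<in> A_level \<phi> n" "b \<in> A_level \<phi> n" for a b
    unfolding A_level_eq
    by (rule span_mult_closed[OF _ that[unfolded A_level_eq]]) (elim imageE, simp only: mult)
  have "star (\<phi> (n + 1) p) \<in> complex_vector.span (\<phi> (n + 1) ` A_gens n)" if "p \<in> A_gens n" for p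
    unfolding adjoint[OF A_gens_in_tensor_algebra[OF that], symmetric]
    by (intro complex_vector.span_base imageI mat_adjoint_A_gens that)
  note star = this
  show "star a \<in> A_level \<phi> n" if "a \<in> A_level \<phi> n" for a
    unfolding A_level_eq
    by (rule span_star_closed[OF _ that[unfolded A_level_eq]]) (elim imageE, simp only: star)
qed

end

section \<open>Norms of diagonal elements\<close>

text \<open>The coefficient function is defined on words of every length, so that one function such
  as \<open>\<lambda>s. g (word_ext s)\<close> serves all levels.\<close>

definition diag_mat :: "nat \<Rightarrow> (3 list \<Rightarrow> complex) \<Rightarrow> word_matrix" where
  "diag_mat n c = (\<lambda>s t. if s = t \<and> length s = n then c s else 0)"

lemma diag_mat_cong: "(\<And>s. length s = n \<Longrightarrow> c s = d s) \<Longrightarrow> diag_mat n c = diag_mat n d"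
  by (auto simp: diag_mat_def fun_eq_iff)

lemma diag_mat_in_diagonal_algebra: "diag_mat n c \<in> diagonal_algebra n"
  by (auto simp: diag_mat_def diagonal_algebra_def tensor_algebra_def)

lemma diag_mat_in_tensor_algebra: "diag_mat n c \<in> tensor_algebra n"
  using diag_mat_in_diagonal_algebra by (simp add: diagonal_algebra_def)

lemma diagonal_algebraE:
  assumes "x \<in> diagonal_algebra n"
  shows "x = diag_mat n (\<lambda>s. x s s)"
  using assms by (auto simp: diag_mat_def diagonal_algebra_def tensor_algebra_def fun_eq_iff)

lemma mat_add_diag_mat: "mat_add (diag_mat n c) (diag_mat n d) = diag_mat n (\<lambda>s. c s + d s)"
  by (auto simp: mat_add_def diag_mat_def fun_eq_iff)

lemma mat_scale_diag_mat: "mat_scale a (diag_mat n c) = diag_mat n (\<lambda>s. a * c s)"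
  by (auto simp: mat_scale_def diag_mat_def fun_eq_iff)

lemma mat_adjoint_diag_mat: "mat_adjoint (diag_mat n c) = diag_mat n (\<lambda>s. cnj (c s))"
  by (auto simp: mat_adjoint_def diag_mat_def fun_eq_iff)

lemma mat_mult_diag_mat: "mat_mult n (diag_mat n c) (diag_mat n d) = diag_mat n (\<lambda>s. c s * d s)"
proof (intro ext)
  fix s t
  have "mat_mult n (diag_mat n c) (diag_mat n d) s t
      = (\<Sum>u | length u = n. if u = s then (if s = t then c s * d s else 0) else 0)"
    unfolding mat_mult_def by (intro sum.cong) (auto simp: diag_mat_def)
  also have "\<dots> = diag_mat n (\<lambda>s. c s * d s) s t"
    by (subst sum.delta) (auto simp: diag_mat_def)
  finally show "mat_mult n (diag_mat n c) (diag_mat n d) s t = diag_mat n (\<lambda>s. c s * d s) s t" .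
qed

lemma mat_unit_eq_diag_mat: "length s = n \<Longrightarrow> mat_unit s s = diag_mat n (\<lambda>u. if u = s then 1 else 0)"
  by (auto simp: mat_unit_def diag_mat_def fun_eq_iff)

lemma tensor_diag_mat_one: "tensor n (diag_mat n c) (mat_one 1) = diag_mat (Suc n) (\<lambda>s. c (take n s))"
proof (intro ext)
  fix s t :: "3 list"
  have "take n s = take n t \<and> length (take n s) = n \<and> drop n s = drop n t \<and> length (drop n s) = 1
      \<longleftrightarrow> s = t \<and> length s = Suc n"
    by (auto simp: min_def) (metis append_take_drop_id)
  then show "tensor n (diag_mat n c) (mat_one 1) s t = diag_mat (Suc n) (\<lambda>s. c (take n s)) s t"
    unfolding tensor_def diag_mat_def mat_one_def by auto
qed

text \<open>In the limit of 2^(k+1)-th roots the constant N becomes irrelevant. Without roots: if x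
  > M > 0, some power of x / M already exceeds N.\<close>

lemma le_of_power_bound:
  fixes x :: real
  assumes M: "M \<ge> 0" and x: "x \<ge> 0" and bound: "\<And>k. x ^ (2 ^ Suc k) \<le> N * M ^ (2 ^ Suc k)"
  shows "x \<le> M"
proof (rule ccontr)
  assume "\<not> x \<le> M"
  then have "x > M" by simp
  have "M > 0"
  proof (rule ccontr)
    assume "\<not> M > 0"
    with M have "M = 0" by simp
    with bound[of 0] \<open>x > M\<close> show False by (simp add: power2_eq_square mult_le_0_iff)
  qed
  have "1 < x / M" using \<open>x > M\<close> \<open>M > 0\<close> by simp
  then obtain k where k: "N < (x / M) ^ k"
    using real_arch_pow by blast
  also have "(x / M) ^ k \<le> (x / M) ^ (2 ^ Suc k)"
  proof (rule power_increasing)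
    show "k \<le> 2 ^ Suc k"
      using less_exp[of "Suc k"] by linarith
  qed (use \<open>1 < x / M\<close> in simp)
  also have "\<dots> \<le> N"
    using bound[of k] \<open>M > 0\<close> by (simp add: power_divide divide_le_eq)
  finally show False by simp
qed

context uhf3
begin

definition diag_elem :: "nat \<Rightarrow> (3 list \<Rightarrow> complex) \<Rightarrow> 'a" where
  "diag_elem n c = \<phi> n (diag_mat n c)"

lemma diag_elem_cong: "(\<And>s. length s = n \<Longrightarrow> c s = d s) \<Longrightarrow> diag_elem n c = diag_elem n d"
  unfolding diag_elem_def by (metis diag_mat_cong)

lemma diag_elem_add: "diag_elem n (\<lambda>s. c s + d s) = diag_elem n c + diag_elem n d"
  by (simp add: diag_elem_def add diag_mat_in_tensor_algebra flip: mat_add_diag_mat)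

lemma diag_elem_scale: "diag_elem n (\<lambda>s. a * c s) = scaleC a (diag_elem n c)"
  by (simp add: diag_elem_def scale diag_mat_in_tensor_algebra flip: mat_scale_diag_mat)

lemma diag_elem_mult: "diag_elem n (\<lambda>s. c s * d s) = diag_elem n c * diag_elem n d"
  by (simp add: diag_elem_def mult diag_mat_in_tensor_algebra flip: mat_mult_diag_mat)

lemma diag_elem_star: "diag_elem n (\<lambda>s. cnj (c s)) = star (diag_elem n c)"
  by (simp add: diag_elem_def adjoint diag_mat_in_tensor_algebra flip: mat_adjoint_diag_mat)

lemma diag_elem_diff: "diag_elem n (\<lambda>s. c s - d s) = diag_elem n c - diag_elem n d"
proof -
  have "diag_elem n (\<lambda>s. c s - d s) + diag_elem n d = diag_elem n c"
    by (simp flip: diag_elem_add)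
  then show ?thesis by (simp add: eq_diff_eq)
qed

lemma diag_elem_compatible: "m \<ge> n \<Longrightarrow> diag_elem m (\<lambda>s. c (take n s)) = diag_elem n c"
proof (induction m rule: dec_induct)
  case base
  show ?case by (rule diag_elem_cong) simp
next
  case (step m)
  have "diag_elem (Suc m) (\<lambda>s. c (take n s)) = diag_elem (Suc m) (\<lambda>s. c (take n (take m s)))"
    using step by (intro diag_elem_cong) simp
  also have "\<dots> = diag_elem m (\<lambda>s. c (take n s))"
    unfolding diag_elem_def tensor_diag_mat_one[of m "\<lambda>s. c (take n s)", symmetric]
    by (rule compatible[OF diag_mat_in_tensor_algebra])
  finally show ?case using step.IH by simp
qed

text \<open>The image p is a projection, so the C*-identity reads
  \<open>norm p = (norm p)\<^sup>2\<close>; injectivity of \<open>\<phi> n\<close> excludes p =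
  0.\<close>

lemma norm_phi_mat_unit:
  assumes "length s = n"
  shows "norm (\<phi> n (mat_unit s s)) = 1"
proof -
  define p where "p = diag_elem n (\<lambda>u. if u = s then 1 else 0)"
  have p: "\<phi> n (mat_unit s s) = p"
    using assms by (simp add: p_def diag_elem_def mat_unit_eq_diag_mat)
  have "star p = p" "p * p = p"
    unfolding p_def diag_elem_star[symmetric] diag_elem_mult[symmetric] by (auto intro: diag_elem_cong)
  then have "norm p = (norm p)\<^sup>2"
    using cstar_identity[of p] by simp
  moreover have "p \<noteq> 0"
  proof
    assume "p = 0"
    then have "mat_unit s s = (\<lambda>_ _. 0)"
      using inj_onD[OF inj, of n "mat_unit s s" "\<lambda>_ _. 0"] assms
      by (simp add: p mat_unit_in_tensor_algebra)
    then show False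
      by (metis mat_unit_def zero_neq_one)
  qed
  ultimately show ?thesis
    by (simp add: p power2_eq_square)
qed

text \<open>Multiplying by the norm-one projection at the word s isolates the entry
  \<open>c s\<close>, and such a multiplication does not increase the norm.\<close>

lemma norm_diag_elem_ge:
  assumes "length s = n"
  shows "cmod (c s) \<le> norm (diag_elem n c)"
proof -
  let ?p = "diag_elem n (\<lambda>u. if u = s then 1 else 0)"
  have p: "norm ?p = 1"
    using norm_phi_mat_unit[OF assms] assms by (simp add: diag_elem_def mat_unit_eq_diag_mat)
  have "?p * diag_elem n c = scaleC (c s) ?p"
    unfolding diag_elem_scale[symmetric] diag_elem_mult[symmetric] by (auto intro: diag_elem_cong)
  then have "cmod (c s) = norm (?p * diag_elem n c)"
    by (simp add: norm_scaleC p)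
  also have "\<dots> \<le> norm (diag_elem n c)"
    using norm_mult_ineq[of ?p "diag_elem n c"] p by simp
  finally show ?thesis .
qed

lemma diag_elem_eq_sum: "diag_elem n c = (\<Sum>s | length s = n. scaleC (c s) (\<phi> n (mat_unit s s)))"
proof -
  have "diag_mat n c = (\<lambda>u t. \<Sum>s | length s = n. mat_scale (c s) (mat_unit s s) u t)"
  proof (intro ext)
    fix u t
    have "(\<Sum>s | length s = n. mat_scale (c s) (mat_unit s s) u t)
        = (\<Sum>s | length s = n. if s = u then (if u = t then c u else 0) else 0)"
      by (intro sum.cong) (auto simp: mat_scale_def mat_unit_def)
    also have "\<dots> = diag_mat n c u t"
      by (subst sum.delta) (auto simp: diag_mat_def)
    finally show "diag_mat n c u t = (\<Sum>s | length s = n. mat_scale (c s) (mat_unit s s) u t)" by simp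
  qed
  moreover have "mat_scale (c s) (mat_unit s s) \<in> tensor_algebra n" if "length s = n" for s
    using that by (auto simp: tensor_algebra_def mat_scale_def mat_unit_def)
  ultimately have "diag_elem n c = (\<Sum>s | length s = n. \<phi> n (mat_scale (c s) (mat_unit s s)))"
    using phi_sum[of "{s. length s = n}" "\<lambda>s. mat_scale (c s) (mat_unit s s)" n]
    by (simp add: diag_elem_def)
  then show ?thesis
    by (simp add: scale mat_unit_in_tensor_algebra)
qed

lemma norm_diag_elem_le_sum: "norm (diag_elem n c) \<le> (\<Sum>s | length s = n. cmod (c s))"
  unfolding diag_elem_eq_sum
  by (rule order_trans[OF norm_sum]) (simp add: norm_scaleC norm_phi_mat_unit)

text \<open>One use of the C*-identity replaces the entries by their squared moduli. From then on
  they are nonnegative reals and each further squaring just squares them, which is why the exponents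
  start at 2.\<close>

lemma norm_diag_elem_power:
  "norm (diag_elem n c) ^ (2 ^ Suc k) = norm (diag_elem n (\<lambda>s. of_real (cmod (c s) ^ (2 ^ Suc k))))"
proof (induction k)
  case 0
  have "(norm (diag_elem n c))\<^sup>2 = norm (diag_elem n (\<lambda>s. cnj (c s) * c s))"
    by (simp add: diag_elem_mult diag_elem_star cstar_identity)
  also have "(\<lambda>s. cnj (c s) * c s) = (\<lambda>s. of_real ((cmod (c s))\<^sup>2))"
    by (simp add: complex_norm_square mult.commute del: of_real_power)
  finally show ?case by simp
next
  case (Suc k)
  let ?d = "\<lambda>s. complex_of_real (cmod (c s) ^ (2 ^ Suc k))"
  have "norm (diag_elem n c) ^ (2 ^ Suc (Suc k)) = (norm (diag_elem n ?d))\<^sup>2"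
    unfolding Suc.IH[symmetric] by (simp add: power_mult[symmetric] mult.commute)
  also have "\<dots> = norm (diag_elem n (\<lambda>s. cnj (?d s) * ?d s))"
    by (simp only: diag_elem_mult diag_elem_star cstar_identity)
  also have "(\<lambda>s. cnj (?d s) * ?d s) = (\<lambda>s. of_real (cmod (c s) ^ (2 ^ Suc (Suc k))))"
    by (simp add: power_mult[symmetric] power_add[symmetric] mult_2)
  finally show ?case .
qed

text \<open>By the C*-identity the crude triangle bound also holds for the powers with exponent \<open>2 ^ k\<close>,
  and the factor counting the words disappears as \<open>k\<close> grows.\<close>

lemma norm_diag_elem_le:
  assumes M: "M \<ge> 0" and c: "\<And>s. length s = n \<Longrightarrow> cmod (c s) \<le> M"
  shows "norm (diag_elem n c) \<le> M"
proof (rule le_of_power_bound[OF M norm_ge_zero])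
  fix k
  have "norm (diag_elem n c) ^ (2 ^ Suc k) \<le> (\<Sum>s | length s = n. cmod (of_real (cmod (c s) ^ (2 ^ Suc k))))"
    unfolding norm_diag_elem_power by (rule norm_diag_elem_le_sum)
  also have "\<dots> \<le> (\<Sum>s :: 3 list | length s = n. M ^ (2 ^ Suc k))"
    using c by (intro sum_mono) (auto simp: norm_power intro!: power_mono)
  finally show "norm (diag_elem n c) ^ (2 ^ Suc k)
      \<le> real (card {s :: 3 list. length s = n}) * M ^ (2 ^ Suc k)"
    by simp
qed

end

section \<open>Continuous functions on the Cantor space\<close>

lemma isometric_star_homD:
  assumes "isometric_star_hom X F h" "f \<in> F"
  shows isometric_star_hom_add: "g \<in> F \<Longrightarrow> h (\<lambda>x. f x + g x) = h f + h g"
    and isometric_star_hom_scale: "h (\<lambda>x. c * f x) = scaleC c (h f)"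
    and isometric_star_hom_mult: "g \<in> F \<Longrightarrow> h (\<lambda>x. f x * g x) = h f * h g"
    and isometric_star_hom_star: "h (\<lambda>x. cnj (f x)) = star (h f)"
    and isometric_star_hom_norm: "norm (h f) = (SUP x\<in>X. cmod (f x))"
  using assms by (auto simp: isometric_star_hom_def)

text \<open>The common frame for \<open>C_cantor\<close> and for the functions continuous on K, so
  that closedness of the isometric image is proved once. \<open>uniform_limit_in\<close> is
  completeness for the supremum norm over X; it also forces membership in F to depend only on the
  values on X.\<close>

locale uniform_function_algebra =
  fixes X :: "'x set" and F :: "('x \<Rightarrow> complex) set"
  assumes X_nonempty: "X \<noteq> {}"
    and const_in: "(\<lambda>_. c) \<in> F"
    and add_in: "\<lbrakk>f \<in> F; g \<in> F\<rbrakk> \<Longrightarrow> (\<lambda>x. f x + g x) \<in> F"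
    and mult_in: "\<lbrakk>f \<in> F; g \<in> F\<rbrakk> \<Longrightarrow> (\<lambda>x. f x * g x) \<in> F"
    and cnj_in: "f \<in> F \<Longrightarrow> (\<lambda>x. cnj (f x)) \<in> F"
    and bounded_range: "f \<in> F \<Longrightarrow> bdd_above ((\<lambda>x. cmod (f x)) ` X)"
    and uniform_limit_in: "\<lbrakk>\<And>n :: nat. fs n \<in> F; uniform_limit X fs f sequentially\<rbrakk> \<Longrightarrow> f \<in> F"
begin

lemma scale_in: "f \<in> F \<Longrightarrow> (\<lambda>x. c * f x) \<in> F"
  by (rule mult_in[OF const_in])

lemma sum_in: "(\<And>i. i \<in> I \<Longrightarrow> f i \<in> F) \<Longrightarrow> (\<lambda>x. \<Sum>i\<in>I. f i x) \<in> F"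
  by (induction I rule: infinite_finite_induct) (auto intro: const_in add_in)

lemma diff_in: "\<lbrakk>f \<in> F; g \<in> F\<rbrakk> \<Longrightarrow> (\<lambda>x. f x - g x) \<in> F"
  using add_in[of f "\<lambda>x. - 1 * g x"] scale_in[of g "- 1"] by simp

context
  fixes h :: "('x \<Rightarrow> complex) \<Rightarrow> 'a::cstar_algebra"
  assumes hom: "isometric_star_hom X F h"
begin

lemma hom_sum:
  "(\<And>i. i \<in> I \<Longrightarrow> f i \<in> F) \<Longrightarrow> h (\<lambda>x. \<Sum>i\<in>I. f i x) = (\<Sum>i\<in>I. h (f i))"
proof (induction I rule: infinite_finite_induct)
  case (insert i I)
  then show ?case
    using isometric_star_hom_add[OF hom, of "f i" "\<lambda>x. \<Sum>i\<in>I. f i x"] by (simp add: sum_in)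
qed (use isometric_star_hom_scale[OF hom const_in[of 0], of 0] in simp_all)

lemma hom_diff:
  assumes "f \<in> F" "g \<in> F"
  shows "h (\<lambda>x. f x - g x) = h f - h g"
  using isometric_star_hom_add[OF hom diff_in[OF assms] assms(2)] by (simp add: eq_diff_eq)

lemma cmod_diff_le:
  assumes "f \<in> F" "g \<in> F" "x \<in> X"
  shows "cmod (f x - g x) \<le> norm (h f - h g)"
  using cSUP_upper[OF assms(3) bounded_range[OF diff_in[OF assms(1,2)]]]
  by (simp add: isometric_star_hom_norm[OF hom] diff_in assms flip: hom_diff)

lemma norm_hom_diff_le:
  assumes "f \<in> F" "g \<in> F" "\<And>x. x \<in> X \<Longrightarrow> cmod (f x - g x) \<le> e"
  shows "norm (h f - h g) \<le> e"
  using cSUP_least[OF X_nonempty assms(3)]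
  by (simp add: isometric_star_hom_norm[OF hom] diff_in assms(1,2) flip: hom_diff)

text \<open>By isometry, preimages of a convergent sequence are uniformly Cauchy on X; their uniform
  limit stays in F and is a preimage of the limit.\<close>

lemma closed_hom_image: "closed (h ` F)"
  unfolding closed_sequential_limits
proof (intro allI impI, elim conjE)
  fix y a
  assume "\<forall>n. y n \<in> h ` F" and lim: "y \<longlonglongrightarrow> a"
  then have "\<forall>n. \<exists>f. f \<in> F \<and> y n = h f" by blast
  then obtain fs where "\<forall>n. fs n \<in> F \<and> y n = h (fs n)"
    by (rule choice[THEN exE])
  then have fs: "\<And>n. fs n \<in> F" "\<And>n. y n = h (fs n)" by simp_all
  have Cauchy: "uniformly_Cauchy_on X fs"
    unfolding uniformly_Cauchy_on_def
  proof (intro allI impI)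
    fix e :: real assume "e > 0"
    then obtain M where M: "\<And>m n. m \<ge> M \<Longrightarrow> n \<ge> M \<Longrightarrow> dist (y m) (y n) < e"
      using LIMSEQ_imp_Cauchy[OF lim] by (metis Cauchy_def)
    have "dist (fs m x) (fs n x) < e" if "x \<in> X" "m \<ge> M" "n \<ge> M" for x m n
      using cmod_diff_le[OF fs(1) fs(1) that(1), of m n] M[OF that(2,3)] by (simp add: dist_norm fs(2))
    then show "\<exists>M. \<forall>x\<in>X. \<forall>m\<ge>M. \<forall>n\<ge>M. dist (fs m x) (fs n x) < e" by blast
  qed
  \<comment> \<open>Outside X this \<open>lim\<close> may be an arbitrary value, which is harmless
    because only values on X count.\<close>
  define f where "f = (\<lambda>x. lim (\<lambda>n. fs n x))"
  have f: "uniform_limit X fs f sequentially"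
    unfolding f_def uniformly_convergent_uniform_limit_iff[symmetric]
    by (rule Cauchy_uniformly_convergent[OF Cauchy])
  have "f \<in> F" by (rule uniform_limit_in[OF fs(1) f])
  have "y \<longlonglongrightarrow> h f"
  proof (rule tendstoI)
    fix e :: real assume "e > 0"
    then have "\<forall>\<^sub>F n in sequentially. \<forall>x\<in>X. dist (fs n x) (f x) < e / 2"
      using uniform_limitD[OF f, of "e / 2"] by simp
    then show "\<forall>\<^sub>F n in sequentially. dist (y n) (h f) < e"
    proof eventually_elim
      case (elim n)
      then have "norm (h (fs n) - h f) \<le> e / 2"
        by (intro norm_hom_diff_le fs(1) \<open>f \<in> F\<close>) (auto simp: dist_norm less_imp_le)
      with \<open>e > 0\<close> show ?case by (simp add: dist_norm fs(2))
    qed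
  qed
  with lim have "a = h f" by (rule LIMSEQ_unique)
  with \<open>f \<in> F\<close> show "a \<in> h ` F" by blast
qed

lemma cstar_subalgebra_hom_image: "cstar_subalgebra (h ` F)"
  unfolding cstar_subalgebra_def complex_vector.subspace_def
proof (intro conjI ballI allI closed_hom_image; (elim imageE)?; hypsubst?)
  show "0 \<in> h ` F"
    using isometric_star_hom_scale[OF hom const_in[of 0], of 0]
    by (intro image_eqI[of _ _ "\<lambda>_. 0"] const_in) simp
  fix f g c
  assume f: "f \<in> F"
  show "scaleC c (h f) \<in> h ` F"
    unfolding isometric_star_hom_scale[OF hom f, symmetric] by (intro imageI scale_in f)
  show "star (h f) \<in> h ` F"
    unfolding isometric_star_hom_star[OF hom f, symmetric] by (intro imageI cnj_in f)
  assume g: "g \<in> F"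
  show "h f + h g \<in> h ` F"
    unfolding isometric_star_hom_add[OF hom f g, symmetric] by (intro imageI add_in f g)
  show "h f * h g \<in> h ` F"
    unfolding isometric_star_hom_mult[OF hom f g, symmetric] by (intro imageI mult_in f g)
qed

lemma hom_image_commute:
  assumes "a \<in> h ` F" "b \<in> h ` F" shows "a * b = b * a"
  using assms by (auto simp: mult.commute simp flip: isometric_star_hom_mult[OF hom])

end

end

text \<open>The padding letter is 2 to match the tails of e_22 in \<alpha> and \<beta>, and because
  \<open>w 2\<close> fixes \<open>v 2\<close>.\<close>

definition word_ext :: "3 list \<Rightarrow> nat \<Rightarrow> 3" where
  "word_ext s i = (if i < length s then s ! i else 2)"

lemma length_prefix_word [simp]: "length (prefix_word \<sigma> n) = n"
  by (simp add: prefix_word_def)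

lemma prefix_word_0 [simp]: "prefix_word \<sigma> 0 = []"
  by (simp add: prefix_word_def)

lemma prefix_word_Suc: "prefix_word \<sigma> (Suc n) = prefix_word \<sigma> n @ [\<sigma> n]"
  by (simp add: prefix_word_def)

lemma prefix_word_eq_iff: "prefix_word \<sigma> n = prefix_word \<tau> n \<longleftrightarrow> (\<forall>i<n. \<sigma> i = \<tau> i)"
  by (auto simp: prefix_word_def)

lemma take_prefix_word: "n \<le> m \<Longrightarrow> take n (prefix_word \<sigma> m) = prefix_word \<sigma> n"
  by (simp add: prefix_word_def take_map)

lemma prefix_word_ext: "n \<le> length s \<Longrightarrow> prefix_word (word_ext s) n = take n s"
  by (auto simp: prefix_word_def word_ext_def intro!: nth_equalityI)

lemma prefix_word_ext_prefix_word: "prefix_word (word_ext (prefix_word \<sigma> n)) n = prefix_word \<sigma> n"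
  by (simp add: prefix_word_ext)

section \<open>The Cantor space and its continuous functions\<close>

lemma topspace_cantor_space [simp]: "topspace cantor_space = UNIV"
  by (simp add: cantor_space_def)

text \<open>Cylinders form a base: a basic open set of the product restricts finitely many
  coordinates, all of them below some n.\<close>

lemma openin_cantor_space:
  "openin cantor_space U \<longleftrightarrow> (\<forall>\<sigma>\<in>U. \<exists>n. cylinder (prefix_word \<sigma> n) \<subseteq> U)"
proof
  assume U: "openin cantor_space U"
  show "\<forall>\<sigma>\<in>U. \<exists>n. cylinder (prefix_word \<sigma> n) \<subseteq> U"
  proof
    fix \<sigma> assume "\<sigma> \<in> U"
    then obtain V where V: "finite {i. V i \<noteq> UNIV}" "\<sigma> \<in> Pi\<^sub>E UNIV V" "Pi\<^sub>E UNIV V \<subseteq> U"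
      using U unfolding cantor_space_def openin_product_topology_alt by auto
    then obtain n where n: "\<And>i. V i \<noteq> UNIV \<Longrightarrow> i < n"
      unfolding finite_nat_set_iff_bounded by blast
    have "cylinder (prefix_word \<sigma> n) \<subseteq> Pi\<^sub>E UNIV V"
    proof
      fix \<tau> assume "\<tau> \<in> cylinder (prefix_word \<sigma> n)"
      then have "\<forall>i<n. \<tau> i = \<sigma> i" by (simp add: cylinder_def prefix_word_eq_iff)
      with n V(2) show "\<tau> \<in> Pi\<^sub>E UNIV V"
        unfolding PiE_UNIV_domain Pi_iff by (metis UNIV_I)
    qed
    with V(3) show "\<exists>n. cylinder (prefix_word \<sigma> n) \<subseteq> U" by blast
  qed
next
  assume U: "\<forall>\<sigma>\<in>U. \<exists>n. cylinder (prefix_word \<sigma> n) \<subseteq> U"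
  show "openin cantor_space U"
    unfolding cantor_space_def openin_product_topology_alt
  proof
    fix \<sigma> assume "\<sigma> \<in> U"
    with U obtain n where n: "cylinder (prefix_word \<sigma> n) \<subseteq> U" by blast
    define V where "V = (\<lambda>i. if i < n then {\<sigma> i} else UNIV)"
    have "Pi\<^sub>E UNIV V \<subseteq> U"
    proof
      fix \<tau> assume "\<tau> \<in> Pi\<^sub>E UNIV V"
      then have "\<forall>i<n. \<tau> i = \<sigma> i"
        by (auto simp: PiE_UNIV_domain Pi_iff V_def split: if_splits)
      with n show "\<tau> \<in> U" by (auto simp: cylinder_def prefix_word_eq_iff)
    qed
    moreover have "finite {i. V i \<noteq> UNIV}"
      by (rule finite_subset[of _ "{..<n}"]) (auto simp: V_def)
    ultimately show "\<exists>V. finite {i \<in> UNIV. V i \<noteq> topspace (discrete_topology UNIV)} \<and>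
        (\<forall>i\<in>UNIV. openin (discrete_topology UNIV) (V i)) \<and> \<sigma> \<in> Pi\<^sub>E UNIV V \<and> Pi\<^sub>E UNIV V \<subseteq> U"
      by (intro exI[of _ V]) (auto simp: V_def)
  qed
qed

text \<open>Uniform continuity by compactness: finitely many cylinders on which g oscillates by less
  than e cover the space, and n bounds the lengths of their words.\<close>

lemma C_cantor_iff:
  "g \<in> C_cantor \<longleftrightarrow>
    (\<forall>e>0. \<exists>n. \<forall>\<sigma> \<tau>. prefix_word \<sigma> n = prefix_word \<tau> n \<longrightarrow> dist (g \<sigma>) (g \<tau>) < e)"
proof
  assume "g \<in> C_cantor"
  then have cont: "openin cantor_space (g -` U)" if "open U" for U
    using that unfolding C_cantor_def by (auto simp: continuous_map_def vimage_def)
  show "\<forall>e>0. \<exists>n. \<forall>\<sigma> \<tau>. prefix_word \<sigma> n = prefix_word \<tau> n \<longrightarrow> dist (g \<sigma>) (g \<tau>) < e"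
  proof (intro allI impI)
    fix e :: real assume "e > 0"
    define S where "S = {s. \<forall>\<sigma>\<in>cylinder s. \<forall>\<tau>\<in>cylinder s. dist (g \<sigma>) (g \<tau>) < e}"
    have open_cyl: "openin cantor_space (cylinder s)" for s
      unfolding openin_cantor_space cylinder_def by (auto intro!: exI[of _ "length s"])
    have "\<sigma> \<in> \<Union> (cylinder ` S)" for \<sigma>
    proof -
      obtain n where n: "cylinder (prefix_word \<sigma> n) \<subseteq> g -` ball (g \<sigma>) (e / 2)"
        using cont[OF open_ball, of "g \<sigma>" "e / 2"] \<open>e > 0\<close> unfolding openin_cantor_space by force
      have "prefix_word \<sigma> n \<in> S"
        unfolding S_def
      proof (intro CollectI ballI)
        fix \<tau> \<rho> assume "\<tau> \<in> cylinder (prefix_word \<sigma> n)" "\<rho> \<in> cylinder (prefix_word \<sigma> n)"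
        with n have "dist (g \<sigma>) (g \<tau>) < e / 2" "dist (g \<sigma>) (g \<rho>) < e / 2" by auto
        then show "dist (g \<tau>) (g \<rho>) < e"
          by (metis dist_commute dist_triangle_half_l)
      qed
      moreover have "\<sigma> \<in> cylinder (prefix_word \<sigma> n)" by (simp add: cylinder_def)
      ultimately show ?thesis by blast
    qed
    then have cover: "(\<forall>U\<in>cylinder ` S. openin cantor_space U) \<and> topspace cantor_space \<subseteq> \<Union> (cylinder ` S)"
      using open_cyl by auto
    have compact: "compact_space cantor_space"
      by (simp add: cantor_space_def compact_space_product_topology compact_space_discrete_topology)
    obtain T where "finite T" "T \<subseteq> cylinder ` S" "UNIV \<subseteq> \<Union> T"
      using compact[unfolded compact_space_alt, THEN spec, THEN mp, OF cover] by auto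
    from finite_subset_image[OF this(1,2)] this(3)
    obtain R where R: "R \<subseteq> S" "finite R" "UNIV \<subseteq> \<Union> (cylinder ` R)"
      by blast
    then obtain n where n: "\<And>s. s \<in> R \<Longrightarrow> length s \<le> n"
      using finite_imageI[OF R(2), of length] unfolding finite_nat_set_iff_bounded_le by blast
    have "dist (g \<sigma>) (g \<tau>) < e" if eq: "prefix_word \<sigma> n = prefix_word \<tau> n" for \<sigma> \<tau>
    proof -
      obtain s where s: "s \<in> R" "\<sigma> \<in> cylinder s" using R(3) by blast
      then have "prefix_word \<tau> (length s) = prefix_word \<sigma> (length s)"
        using eq n[OF s(1)] by (metis take_prefix_word)
      with s R(1) show ?thesis by (auto simp: cylinder_def S_def)
    qed
    then show "\<exists>n. \<forall>\<sigma> \<tau>. prefix_word \<sigma> n = prefix_word \<tau> n \<longrightarrow> dist (g \<sigma>) (g \<tau>) < e" by blast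
  qed
next
  assume unif: "\<forall>e>0. \<exists>n. \<forall>\<sigma> \<tau>. prefix_word \<sigma> n = prefix_word \<tau> n \<longrightarrow> dist (g \<sigma>) (g \<tau>) < e"
  have "openin cantor_space (g -` U)" if "open U" for U
    unfolding openin_cantor_space
  proof
    fix \<sigma> assume "\<sigma> \<in> g -` U"
    then obtain e where e: "e > 0" "ball (g \<sigma>) e \<subseteq> U"
      using openE[OF \<open>open U\<close>, of "g \<sigma>"] by auto
    then obtain n where "\<And>\<tau>. prefix_word \<sigma> n = prefix_word \<tau> n \<Longrightarrow> dist (g \<sigma>) (g \<tau>) < e"
      using unif by blast
    with e(2) have "cylinder (prefix_word \<sigma> n) \<subseteq> g -` U"
      by (force simp: cylinder_def)
    then show "\<exists>n. cylinder (prefix_word \<sigma> n) \<subseteq> g -` U" by blast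
  qed
  then show "g \<in> C_cantor"
    unfolding C_cantor_def by (auto simp: continuous_map_def vimage_def)
qed

lemma C_cantor_prefix: "(\<lambda>\<sigma>. c (prefix_word \<sigma> n)) \<in> C_cantor"
  unfolding C_cantor_iff by (metis dist_self)

lemma C_cantor_word_ext_dist:
  assumes "g \<in> C_cantor" "e > 0"
  shows "\<forall>\<^sub>F n in sequentially. \<forall>\<sigma>. dist (g (word_ext (prefix_word \<sigma> n))) (g \<sigma>) < e"
proof -
  obtain N where N: "\<And>\<sigma> \<tau>. prefix_word \<sigma> N = prefix_word \<tau> N \<Longrightarrow> dist (g \<sigma>) (g \<tau>) < e"
    using assms unfolding C_cantor_iff by blast
  have "dist (g (word_ext (prefix_word \<sigma> n))) (g \<sigma>) < e" if "n \<ge> N" for n \<sigma>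
    using that by (intro N) (metis prefix_word_ext_prefix_word take_prefix_word)
  then show ?thesis unfolding eventually_sequentially by blast
qed

interpretation cantor: uniform_function_algebra "UNIV :: (nat \<Rightarrow> 3) set" C_cantor
proof
  fix f g :: "(nat \<Rightarrow> 3) \<Rightarrow> complex" and fs and c
  show "(\<lambda>_. c) \<in> C_cantor" by (simp add: C_cantor_def)
  {
    assume f: "f \<in> C_cantor"
    then show "(\<lambda>x. cnj (f x)) \<in> C_cantor"
      by (simp add: C_cantor_def continuous_map_atin tendsto_cnj)
    obtain n where n: "\<And>\<sigma>. dist (f (word_ext (prefix_word \<sigma> n))) (f \<sigma>) < 1"
      using eventually_happens[OF C_cantor_word_ext_dist[OF f, of 1]] by auto
    \<comment> \<open>Up to an error of 1, f depends only on the first n letters, so a maximum over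
      finitely many words bounds it.\<close>
    let ?B = "(\<lambda>s. cmod (f (word_ext s))) ` {s. length s = n}"
    have "cmod (f \<sigma>) \<le> Max ?B + 1" for \<sigma>
    proof -
      have "cmod (f (word_ext (prefix_word \<sigma> n))) \<le> Max ?B"
        by (intro Max_ge) auto
      then show ?thesis
        using n[of \<sigma>] norm_triangle_ineq2[of "f \<sigma>" "f (word_ext (prefix_word \<sigma> n))"]
        unfolding dist_norm norm_minus_commute[of "f (word_ext (prefix_word \<sigma> n))"] by linarith
    qed
    then show "bdd_above (range (\<lambda>x. cmod (f x)))" by (auto intro!: bdd_aboveI2)
    assume g: "g \<in> C_cantor"
    show "(\<lambda>x. f x + g x) \<in> C_cantor" "(\<lambda>x. f x * g x) \<in> C_cantor"
      using f g by (simp_all add: C_cantor_def continuous_map_atin tendsto_add tendsto_mult)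
  }
  assume fs: "\<And>n :: nat. fs n \<in> C_cantor" and lim: "uniform_limit UNIV fs f sequentially"
  show "f \<in> C_cantor"
    unfolding C_cantor_iff
  proof (intro allI impI)
    fix e :: real assume "e > 0"
    then obtain k where k: "\<And>\<sigma>. dist (fs k \<sigma>) (f \<sigma>) < e / 3"
      using eventually_happens[OF uniform_limitD[OF lim, of "e / 3"]] by auto
    obtain n where n: "\<And>\<sigma> \<tau>. prefix_word \<sigma> n = prefix_word \<tau> n \<Longrightarrow> dist (fs k \<sigma>) (fs k \<tau>) < e / 3"
      using fs[of k] \<open>e > 0\<close> unfolding C_cantor_iff by (meson divide_pos_pos zero_less_numeral)
    have "dist (f \<sigma>) (f \<tau>) < e" if "prefix_word \<sigma> n = prefix_word \<tau> n" for \<sigma> \<tau>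
      using n[OF that] k[of \<sigma>] k[of \<tau>] dist_triangle_third by (metis dist_commute)
    then show "\<exists>n. \<forall>\<sigma> \<tau>. prefix_word \<sigma> n = prefix_word \<tau> n \<longrightarrow> dist (f \<sigma>) (f \<tau>) < e" by blast
  qed
qed simp

section \<open>The embedding of the continuous functions on the Cantor space\<close>

context uhf3
begin

text \<open>An explicit candidate for the embedding: at level n, g is sampled at one point of each
  cylinder of length n.\<close>

definition cantor_lim :: "((nat \<Rightarrow> 3) \<Rightarrow> complex) \<Rightarrow> 'a" where
  "cantor_lim g = lim (\<lambda>n. diag_elem n (\<lambda>s. g (word_ext s)))"

lemma cantor_lim:
  assumes g: "g \<in> C_cantor"
  shows "(\<lambda>n. diag_elem n (\<lambda>s. g (word_ext s))) \<longlonglongrightarrow> cantor_lim g"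
proof -
  let ?d = "\<lambda>n. diag_elem n (\<lambda>s. g (word_ext s))"
  have "Cauchy ?d"
  proof (rule metric_CauchyI)
    fix e :: real assume "e > 0"
    then obtain N where N: "\<And>\<sigma> \<tau>. prefix_word \<sigma> N = prefix_word \<tau> N \<Longrightarrow> dist (g \<sigma>) (g \<tau>) < e / 3"
      using g unfolding C_cantor_iff by (meson divide_pos_pos zero_less_numeral)
    have near: "dist (?d m) (?d N) \<le> e / 3" if "m \<ge> N" for m
    proof -
      \<comment> \<open>Lifting the element of level N to level m turns the difference into a single
        diagonal matrix, whose entries control the norm.\<close>
      have "?d m - ?d N = diag_elem m (\<lambda>s. g (word_ext s) - g (word_ext (take N s)))"
        using diag_elem_compatible[OF that, of "\<lambda>s. g (word_ext s)"] by (simp add: diag_elem_diff)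
      also have "norm \<dots> \<le> e / 3"
      proof (rule norm_diag_elem_le)
        fix s :: "3 list" assume "length s = m"
        with that have "dist (g (word_ext s)) (g (word_ext (take N s))) < e / 3"
          by (intro N) (simp add: prefix_word_ext)
        then show "cmod (g (word_ext s) - g (word_ext (take N s))) \<le> e / 3"
          by (simp add: dist_norm)
      qed (use \<open>e > 0\<close> in simp)
      finally show ?thesis by (simp add: dist_norm)
    qed
    have "dist (?d m) (?d n) < e" if "m \<ge> N" "n \<ge> N" for m n
      using near[OF that(1)] near[OF that(2)] dist_triangle2[of "?d m" "?d n" "?d N"] \<open>e > 0\<close> by linarith
    then show "\<exists>M. \<forall>m\<ge>M. \<forall>n\<ge>M. dist (?d m) (?d n) < e" by blast
  qed
  then show ?thesis
    unfolding cantor_lim_def by (simp add: Cauchy_convergent_iff convergent_LIMSEQ_iff)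
qed

lemma cantor_lim_eqI:
  "g \<in> C_cantor \<Longrightarrow> (\<lambda>n. diag_elem n (\<lambda>s. g (word_ext s))) \<longlonglongrightarrow> a \<Longrightarrow> cantor_lim g = a"
  using LIMSEQ_unique[OF cantor_lim] .

text \<open>For a function of the first n letters the approximating sequence is constant from level
  n on.\<close>

lemma cantor_lim_prefix: "cantor_lim (\<lambda>\<sigma>. c (prefix_word \<sigma> n)) = diag_elem n c"
proof (rule cantor_lim_eqI[OF C_cantor_prefix tendsto_eventually])
  have "diag_elem m (\<lambda>s. c (prefix_word (word_ext s) n)) = diag_elem n c" if "m \<ge> n" for m
    using that by (subst diag_elem_compatible[symmetric, OF that])
      (auto simp: prefix_word_ext intro: diag_elem_cong)
  then show "\<forall>\<^sub>F m in sequentially. diag_elem m (\<lambda>s. c (prefix_word (word_ext s) n)) = diag_elem n c"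
    unfolding eventually_sequentially by blast
qed

text \<open>Both bounds for diagonal elements pass to the limit. For the lower one, the entry at
  \<open>prefix_word \<sigma> n\<close> is a value of g that tends to
  \<open>g \<sigma>\<close>.\<close>

lemma norm_cantor_lim:
  assumes g: "g \<in> C_cantor"
  shows "norm (cantor_lim g) = (SUP \<sigma>. cmod (g \<sigma>))"
proof (rule antisym)
  have bdd: "cmod (g \<sigma>) \<le> (SUP \<sigma>. cmod (g \<sigma>))" for \<sigma>
    by (rule cSUP_upper[OF UNIV_I cantor.bounded_range[OF g]])
  then have "norm (diag_elem n (\<lambda>s. g (word_ext s))) \<le> (SUP \<sigma>. cmod (g \<sigma>))" for n
    using order_trans[OF norm_ge_zero bdd] by (intro norm_diag_elem_le) auto
  then show "norm (cantor_lim g) \<le> (SUP \<sigma>. cmod (g \<sigma>))"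
    by (intro LIMSEQ_le_const2[OF tendsto_norm[OF cantor_lim[OF g]]]) auto
  show "(SUP \<sigma>. cmod (g \<sigma>)) \<le> norm (cantor_lim g)"
  proof (rule cSUP_least)
    fix \<sigma>
    have "(\<lambda>n. g (word_ext (prefix_word \<sigma> n))) \<longlonglongrightarrow> g \<sigma>"
    proof (rule tendstoI)
      fix e :: real assume "e > 0"
      from C_cantor_word_ext_dist[OF g this]
      show "\<forall>\<^sub>F n in sequentially. dist (g (word_ext (prefix_word \<sigma> n))) (g \<sigma>) < e"
        by (rule eventually_mono) blast
    qed
    moreover have "cmod (g (word_ext (prefix_word \<sigma> n))) \<le> norm (diag_elem n (\<lambda>s. g (word_ext s)))" for n
      using norm_diag_elem_ge[of "prefix_word \<sigma> n" n "\<lambda>s. g (word_ext s)"] by simp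
    ultimately show "cmod (g \<sigma>) \<le> norm (cantor_lim g)"
      using LIMSEQ_le[OF tendsto_norm tendsto_norm[OF cantor_lim[OF g]]] by blast
  qed simp
qed

lemma isometric_star_hom_cantor_lim: "isometric_star_hom UNIV C_cantor cantor_lim"
  unfolding isometric_star_hom_def
proof (intro conjI ballI allI norm_cantor_lim)
  fix f g c
  assume f: "f \<in> C_cantor"
  note lf = cantor_lim[OF f]
  show "cantor_lim (\<lambda>x. c * f x) = scaleC c (cantor_lim f)"
    using tendsto_scaleC[OF lf] by (intro cantor_lim_eqI cantor.scale_in f) (simp add: diag_elem_scale)
  show "cantor_lim (\<lambda>x. cnj (f x)) = star (cantor_lim f)"
    using tendsto_star[OF lf] by (intro cantor_lim_eqI cantor.cnj_in f) (simp add: diag_elem_star)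
  assume g: "g \<in> C_cantor"
  note lg = cantor_lim[OF g]
  show "cantor_lim (\<lambda>x. f x + g x) = cantor_lim f + cantor_lim g"
    using tendsto_add[OF lf lg] by (intro cantor_lim_eqI cantor.add_in f g) (simp add: diag_elem_add)
  show "cantor_lim (\<lambda>x. f x * g x) = cantor_lim f * cantor_lim g"
    using tendsto_mult[OF lf lg] by (intro cantor_lim_eqI cantor.mult_in f g) (simp add: diag_elem_mult)
qed

lemma indicator_cylinder: "indicator (cylinder s) = (\<lambda>\<sigma>. if prefix_word \<sigma> (length s) = s then 1 else 0)"
  by (auto simp: indicator_def cylinder_def fun_eq_iff)

text \<open>The image contains every diagonal element, as the value of a function of finitely many
  letters, and it is closed because \<open>cantor_lim\<close> is isometric; hence it contains the
  whole closure.\<close>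

lemma is_cantor_embedding_cantor_lim: "is_cantor_embedding \<phi> cantor_lim"
  unfolding is_cantor_embedding_def
proof (intro conjI allI isometric_star_hom_cantor_lim antisym)
  show "cantor_lim (indicator (cylinder s)) = \<phi> (length s) (mat_unit s s)" for s
    using cantor_lim_prefix[of "\<lambda>u. if u = s then 1 else 0" "length s"]
    by (simp add: indicator_cylinder mat_unit_eq_diag_mat[OF refl] flip: diag_elem_def)
  show "cantor_lim ` C_cantor \<subseteq> closure (\<Union>n. \<phi> n ` diagonal_algebra n)"
  proof (rule image_subsetI)
    fix g :: "(nat \<Rightarrow> 3) \<Rightarrow> complex" assume g: "g \<in> C_cantor"
    have "diag_elem n (\<lambda>s. g (word_ext s)) \<in> (\<Union>n. \<phi> n ` diagonal_algebra n)" for n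
      unfolding diag_elem_def using diag_mat_in_diagonal_algebra by blast
    then show "cantor_lim g \<in> closure (\<Union>n. \<phi> n ` diagonal_algebra n)"
      using cantor_lim[OF g] unfolding closure_sequential by (intro exI conjI allI)
  qed
  have "\<phi> n x \<in> cantor_lim ` C_cantor" if "x \<in> diagonal_algebra n" for n x
  proof -
    have "\<phi> n x = cantor_lim (\<lambda>\<sigma>. x (prefix_word \<sigma> n) (prefix_word \<sigma> n))"
      unfolding cantor_lim_prefix[of "\<lambda>s. x s s" n] diag_elem_def
      by (rule arg_cong[OF diagonal_algebraE[OF that]])
    then show ?thesis
      using C_cantor_prefix[of "\<lambda>s. x s s" n] by (rule image_eqI)
  qed
  then show "closure (\<Union>n. \<phi> n ` diagonal_algebra n) \<subseteq> cantor_lim ` C_cantor"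
    by (intro closure_minimal cantor.closed_hom_image[OF isometric_star_hom_cantor_lim]) blast
qed

lemma is_cantor_embedding_cantor_embedding: "is_cantor_embedding \<phi> (cantor_embedding \<phi>)"
  unfolding cantor_embedding_def by (rule someI[of "is_cantor_embedding \<phi>", OF is_cantor_embedding_cantor_lim])

text \<open>This is the uniqueness of the embedding in usable form: the cylinders fix its values on
  functions of finitely many letters, and the isometry carries these values to uniform
  limits.\<close>

lemma cantor_embedding_LIMSEQ:
  assumes g: "g \<in> C_cantor"
  shows "(\<lambda>n. diag_elem n (\<lambda>s. g (word_ext s))) \<longlonglongrightarrow> cantor_embedding \<phi> g"
proof -
  let ?h = "cantor_embedding \<phi>"
  note emb = is_cantor_embedding_cantor_embedding[unfolded is_cantor_embedding_def]
  then have hom: "isometric_star_hom UNIV C_cantor ?h"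
    and cyl: "\<And>s. ?h (indicator (cylinder s)) = \<phi> (length s) (mat_unit s s)" by blast+
  have ind: "indicator (cylinder s) \<in> C_cantor" for s
    unfolding indicator_cylinder by (rule C_cantor_prefix)
  have eq: "diag_elem n (\<lambda>s. g (word_ext s)) = ?h (\<lambda>\<sigma>. g (word_ext (prefix_word \<sigma> n)))" for n
  proof -
    have "(\<lambda>\<sigma>. g (word_ext (prefix_word \<sigma> n)))
        = (\<lambda>\<sigma>. \<Sum>s | length s = n. g (word_ext s) * indicator (cylinder s) \<sigma>)"
    proof
      fix \<sigma>
      have "(\<Sum>s | length s = n. g (word_ext s) * indicator (cylinder s) \<sigma>)
          = (\<Sum>s | length s = n. if s = prefix_word \<sigma> n then g (word_ext s) else 0)"
        by (intro sum.cong) (auto simp: indicator_cylinder)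
      also have "\<dots> = g (word_ext (prefix_word \<sigma> n))"
        by (subst sum.delta) auto
      finally show "g (word_ext (prefix_word \<sigma> n))
        = (\<Sum>s | length s = n. g (word_ext s) * indicator (cylinder s) \<sigma>)" by simp
    qed
    then have "?h (\<lambda>\<sigma>. g (word_ext (prefix_word \<sigma> n)))
        = ?h (\<lambda>\<sigma>. \<Sum>s | length s = n. g (word_ext s) * indicator (cylinder s) \<sigma>)"
      by (rule arg_cong)
    also have "\<dots> = (\<Sum>s | length s = n. ?h (\<lambda>\<sigma>. g (word_ext s) * indicator (cylinder s) \<sigma>))"
      by (intro cantor.hom_sum[OF hom] cantor.scale_in ind)
    also have "\<dots> = diag_elem n (\<lambda>s. g (word_ext s))"
      unfolding diag_elem_eq_sum
      by (intro sum.cong refl) (simp add: isometric_star_hom_scale[OF hom ind] cyl)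
    finally show ?thesis by simp
  qed
  show ?thesis
    unfolding eq
  proof (rule tendstoI)
    fix e :: real assume "e > 0"
    then have "e / 2 > 0" by simp
    from C_cantor_word_ext_dist[OF g this]
    show "\<forall>\<^sub>F n in sequentially. dist (?h (\<lambda>\<sigma>. g (word_ext (prefix_word \<sigma> n)))) (?h g) < e"
    proof eventually_elim
      case (elim n)
      then have "norm (?h (\<lambda>\<sigma>. g (word_ext (prefix_word \<sigma> n))) - ?h g) \<le> e / 2"
        by (intro cantor.norm_hom_diff_le[OF hom _ g] C_cantor_prefix[of "\<lambda>s. g (word_ext s)"])
          (auto simp: dist_norm less_imp_le)
      with \<open>e > 0\<close> show ?case by (simp add: dist_norm)
    qed
  qed
qed

end

section \<open>The gasket\<close>

text \<open>Strip the trailing 2s: either one letter remains, or the run is preceded by a 1 or a 3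
  that has a letter before it. In the induction on the last letter, a further 2 raises k by one,
  while a 1 or a 3 starts with k = 1.\<close>

lemma beta_words_cover:
  "length s = Suc n \<Longrightarrow>
    (\<exists>j. s = j # replicate n 2) \<or> (\<exists>k\<in>{1..n}. \<exists>j. drop (n - k) s \<in> beta_words k j)"
proof (induction n arbitrary: s)
  case 0
  then show ?case by (simp add: length_Suc_conv)
next
  case (Suc n)
  then obtain s' l where s: "s = s' @ [l]" "length s' = Suc n"
    by (metis append_butlast_last_id length_butlast diff_Suc_1 length_0_conv nat.simps(3))
  show ?case
  proof (cases "l = 2")
    case True
    from Suc.IH[OF s(2)] show ?thesis
    proof (elim disjE exE bexE)
      fix j assume "s' = j # replicate n 2"
      then show ?thesis
        using True s by (simp add: replicate_append_same)
    next
      fix k j assume k: "k \<in> {1..n}" and "drop (n - k) s' \<in> beta_words k j"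
      then obtain i m where *: "drop (n - k) s' = i # m # replicate (k - 1) 2"
          "i = j \<and> m = 1 \<or> i = j + 2 \<and> m = 3"
        by (auto simp: beta_words_def)
      have "drop (Suc n - Suc k) s = i # m # replicate (Suc k - 1) 2"
        using *(1) True s k by (simp add: replicate_append_same flip: replicate_Suc)
      then have "drop (Suc n - Suc k) s \<in> beta_words (Suc k) j"
        using *(2) unfolding beta_words_def by auto
      moreover have "Suc k \<in> {1..Suc n}" using k by simp
      ultimately show ?thesis by blast
    qed
  next
    case False
    have "length (drop n s') = 1" using s(2) by simp
    then obtain i where i: "drop n s' = [i]" by (metis One_nat_def length_0_conv length_Suc_conv)
    have drop: "drop (Suc n - 1) s = [i, l]" using s i by simp
    from False have "l = 1 \<or> l = 3" using exhaust_3 by blast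
    then have "\<exists>j. [i, l] \<in> beta_words 1 j"
    proof
      assume "l = 3"
      \<comment> \<open>The letter before a 3 is j + 2, so a word ending in i 3 belongs to j = i -
        2, which is i + 1 modulo 3.\<close>
      have "(i + 1) + 2 = i" by simp
      then have "[i, l] \<in> beta_words 1 (i + 1)"
        unfolding beta_words_def using \<open>l = 3\<close> by (metis diff_self_eq_0 insertCI replicate_0)
      then show ?thesis ..
    qed (auto simp: beta_words_def)
    then obtain j where "drop (Suc n - 1) s \<in> beta_words 1 j" unfolding drop by blast
    then show ?thesis by (intro disjI2 bexI[of _ 1] exI[of _ j]) auto
  qed
qed

text \<open>The supports of the projections partition the words of length n + 1, so exactly one
  summand contributes to each diagonal entry: existence is \<open>beta_words_cover\<close>,
  uniqueness comes from \<open>trailing_twos\<close> and \<open>beta_words_disjoint\<close>. The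
  hypothesis on c lets one coefficient serve both words of a \<beta>.\<close>

lemma diag_mat_eq_sum_A_gens:
  assumes c: "\<And>t k j. c (t @ j # 1 # replicate k 2) = c (t @ (j + 2) # 3 # replicate k 2)"
  shows "diag_mat (n + 1) c = mat_add
    (\<lambda>s t. \<Sum>j\<in>UNIV. mat_scale (c (j # replicate n 2)) (word_proj {j # replicate n 2}) s t)
    (\<lambda>s t. \<Sum>(k, j)\<in>{1..n} \<times> UNIV.
      tensor (n - k) (diag_mat (n - k) (\<lambda>u. c (u @ j # 1 # replicate (k - 1) 2))) (word_proj (beta_words k j)) s t)"
    (is "_ = mat_add ?a ?b")
proof (intro ext)
  fix s t :: "3 list"
  let ?f = "\<lambda>(k, j). tensor (n - k) (diag_mat (n - k) (\<lambda>u. c (u @ j # 1 # replicate (k - 1) 2)))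
    (word_proj (beta_words k j)) s t"
  show "diag_mat (n + 1) c s t = mat_add ?a ?b s t"
  proof (cases "s = t \<and> length s = n + 1")
    case False
    have "diag_mat (n - k) d (take (n - k) s) (take (n - k) t) * word_proj (beta_words k j) (drop (n - k) s) (drop (n - k) t) = 0"
      if "k \<in> {1..n}" for k j d
    proof (rule ccontr)
      assume "\<not> ?thesis"
      then have 1: "take (n - k) s = take (n - k) t" "length (take (n - k) s) = n - k"
          "drop (n - k) s = drop (n - k) t" "drop (n - k) s \<in> beta_words k j"
        by (auto simp: diag_mat_def word_proj_def simp del: length_take split: if_splits)
      then have "s = t" by (metis append_take_drop_id)
      moreover have "length (drop (n - k) s) = Suc k"
        using 1(4) that by (intro length_beta_words) auto
      then have "length s = n + 1" using that by simp
      ultimately show False using False by simp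
    qed
    then have "?b s t = 0" by (auto simp: tensor_def intro!: sum.neutral)
    moreover have "?a s t = 0"
      using False by (auto simp: mat_scale_def word_proj_def intro!: sum.neutral)
    ultimately show ?thesis using False by (auto simp: mat_add_def diag_mat_def)
  next
    case True
    then have [simp]: "t = s" and len: "length s = Suc n" by auto
    have f: "?f (k, j) = (if drop (n - k) s \<in> beta_words k j then c s else 0)" if "k \<in> {1..n}" for k j
    proof (cases "drop (n - k) s \<in> beta_words k j")
      case True
      then have "drop (n - k) s = j # 1 # replicate (k - 1) 2 \<or>
          drop (n - k) s = (j + 2) # 3 # replicate (k - 1) 2"
        by (simp add: beta_words_def)
      then have "c (take (n - k) s @ j # 1 # replicate (k - 1) 2) = c (take (n - k) s @ drop (n - k) s)"
        by (elim disjE) (simp_all only: c)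
      with True len that show ?thesis by (simp add: tensor_def diag_mat_def word_proj_def)
    qed (simp add: tensor_def word_proj_def)
    from beta_words_cover[OF len] have "?a s s + ?b s s = c s"
    proof (elim disjE exE bexE)
      fix j assume s: "s = j # replicate n 2"
      \<comment> \<open>The run of 2s has length n here, while a \<beta> with index k \<le> n would
        force k - 1.\<close>
      have "drop (n - k) s \<notin> beta_words k i" if "k \<in> {1..n}" for k i
        using trailing_twos_beta[of k "n - k" s i] trailing_twos_alpha[of j n] s that by auto
      then have "?b s s = 0" using f by (intro sum.neutral) auto
      moreover have "?a s s = (\<Sum>i\<in>UNIV. if i = j then c s else 0)"
        by (intro sum.cong) (auto simp: mat_scale_def word_proj_def s)
      ultimately show ?thesis by simp
    next
      fix k j assume k: "k \<in> {1..n}" and kj: "drop (n - k) s \<in> beta_words k j"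
      then have trail: "trailing_twos s = k - 1" by (intro trailing_twos_beta) auto
      have "s \<noteq> i # replicate n 2" for i
        using trail trailing_twos_alpha[of i n] k by auto
      then have "?a s s = 0" by (intro sum.neutral) (auto simp: mat_scale_def word_proj_def)
      moreover have "?b s s = (\<Sum>p\<in>{1..n} \<times> UNIV. if p = (k, j) then c s else 0)"
      proof (rule sum.cong)
        fix p :: "nat \<times> 3" assume p: "p \<in> {1..n} \<times> UNIV"
        obtain l i where li: "p = (l, i)" by fastforce
        have "drop (n - l) s \<in> beta_words l i \<longleftrightarrow> l = k \<and> i = j"
        proof
          assume d: "drop (n - l) s \<in> beta_words l i"
          have "trailing_twos s = l - 1" using d p li by (intro trailing_twos_beta) auto
          then have "l = k" using trail p li k by auto
          with d kj beta_words_disjoint[of i j k] show "l = k \<and> i = j" by blast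
        qed (use kj in simp)
        then show "(case p of (k, j) \<Rightarrow> tensor (n - k) (diag_mat (n - k) (\<lambda>u. c (u @ j # 1 # replicate (k - 1) 2)))
            (word_proj (beta_words k j)) s s) = (if p = (k, j) then c s else 0)"
          using f[of l i] p li by simp
      qed simp
      then have "?b s s = c s" using k by simp
      ultimately show ?thesis by simp
    qed
    then show ?thesis using len by (simp add: mat_add_def diag_mat_def)
  qed
qed

text \<open>The coefficients of the \<beta> summands are absorbed into the left leg, a diagonal
  matrix of level n - k, so these summands are generators themselves; the \<alpha> summands take
  their scalars from the span.\<close>

lemma (in uhf3) diag_elem_in_A_level:
  assumes c: "\<And>t k j. c (t @ j # 1 # replicate k 2) = c (t @ (j + 2) # 3 # replicate k 2)"
  shows "diag_elem (n + 1) c \<in> A_level \<phi> n"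
proof -
  let ?p = "\<lambda>j. word_proj {j # replicate n 2}"
  let ?a = "\<lambda>j. mat_scale (c (j # replicate n 2)) (?p j)"
  let ?b = "\<lambda>(k, j). tensor (n - k) (diag_mat (n - k) (\<lambda>u. c (u @ j # 1 # replicate (k - 1) 2))) (word_proj (beta_words k j))"
  let ?I = "{1..n} \<times> (UNIV :: 3 set)"
  have p: "?p j \<in> tensor_algebra (n + 1)" for j
    by (rule A_gens_in_tensor_algebra[OF alpha_in_A_gens])
  then have a: "?a j \<in> tensor_algebra (n + 1)" for j
    by (auto simp: tensor_algebra_def mat_scale_def)
  have b: "?b i \<in> A_gens n" if "i \<in> ?I" for i
    using that by (auto intro!: beta_in_A_gens diag_mat_in_tensor_algebra)
  note b' = A_gens_in_tensor_algebra[OF b]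
  have "diag_mat (n + 1) c = mat_add (\<lambda>s t. \<Sum>j\<in>UNIV. ?a j s t) (\<lambda>s t. \<Sum>i\<in>?I. ?b i s t)"
    using diag_mat_eq_sum_A_gens[OF c, of n] by (simp add: case_prod_beta)
  then have "diag_elem (n + 1) c = \<phi> (n + 1) (\<lambda>s t. \<Sum>j\<in>UNIV. ?a j s t) + \<phi> (n + 1) (\<lambda>s t. \<Sum>i\<in>?I. ?b i s t)"
    unfolding diag_elem_def using add[OF sum_in_tensor_algebra[OF a] sum_in_tensor_algebra[OF b']] by simp
  also have "\<dots> = (\<Sum>j\<in>UNIV. \<phi> (n + 1) (?a j)) + (\<Sum>i\<in>?I. \<phi> (n + 1) (?b i))"
    using phi_sum[of UNIV ?a "n + 1", OF a] phi_sum[of ?I ?b "n + 1", OF b'] by simp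
  also have "(\<Sum>j\<in>UNIV. \<phi> (n + 1) (?a j)) = (\<Sum>j\<in>UNIV. scaleC (c (j # replicate n 2)) (\<phi> (n + 1) (?p j)))"
    using p by (intro sum.cong scale refl)
  also have "\<dots> + (\<Sum>i\<in>?I. \<phi> (n + 1) (?b i)) \<in> A_level \<phi> n"
    unfolding A_level_eq
    by (intro complex_vector.span_add complex_vector.span_sum complex_vector.span_scale
        complex_vector.span_base imageI alpha_in_A_gens b)
  finally show ?thesis .
qed

section \<open>The coding map of the gasket\<close>

context sierpinski_gasket
begin

lemma w_in_K: "x \<in> K \<Longrightarrow> w j x \<in> K"
  using self_similar by blast

lemma dist_foldr_w: "dist (foldr w s x) (foldr w s y) = (1 / 2) ^ length s * dist x y"
  by (induction s) (simp_all add: ratio)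

lemma compact_foldr_w: "compact (foldr w s ` K)"
proof (rule compact_continuous_image[OF _ compact])
  have "1-lipschitz_on K (foldr w s)"
    by (rule lipschitz_onI) (auto simp: dist_foldr_w intro!: mult_left_le_one_le power_le_one)
  then show "continuous_on K (foldr w s)" by (rule lipschitz_on_continuous_on)
qed

lemma dist_foldr_w_le:
  assumes "x \<in> foldr w s ` K" "y \<in> foldr w s ` K"
  shows "dist x y \<le> (1 / 2) ^ length s * diameter K"
  using assms diameter_bounded_bound[OF compact_imp_bounded[OF compact]]
  by (auto simp: dist_foldr_w intro!: mult_left_mono)

lemma foldr_w_prefix_mono:
  assumes "n \<le> m"
  shows "foldr w (prefix_word \<sigma> m) ` K \<subseteq> foldr w (prefix_word \<sigma> n) ` K"
  using assms
proof (induction m rule: dec_induct)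
  case (step m)
  have "foldr w (prefix_word \<sigma> (Suc m)) ` K \<subseteq> foldr w (prefix_word \<sigma> m) ` K"
    by (auto simp: prefix_word_Suc intro!: imageI w_in_K)
  with step.IH show ?case by blast
qed simp

text \<open>Cells of level n have diameter at most \<open>(1 / 2) ^ n * diameter K\<close>, so their
  intersection has at most one point. Computing the coding map thus reduces to membership in all
  cells.\<close>

lemma coding_map_eqI:
  assumes "\<And>n. x \<in> foldr w (prefix_word \<sigma> n) ` K"
  shows "coding_map w K \<sigma> = x"
  unfolding coding_map_def
proof (rule the_equality)
  fix y assume "y \<in> (\<Inter>n. foldr w (prefix_word \<sigma> n) ` K)"
  then have "dist y x \<le> (1 / 2) ^ n * diameter K" for n
    using dist_foldr_w_le[of y "prefix_word \<sigma> n" x] assms by auto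
  moreover have "(\<lambda>n. (1 / 2) ^ n * diameter K) \<longlonglongrightarrow> 0 * diameter K"
    by (intro tendsto_mult LIMSEQ_realpow_zero tendsto_const) auto
  ultimately have "dist y x \<le> 0"
    by (intro LIMSEQ_le_const[of _ 0]) auto
  then show "y = x" by simp
qed (use assms in blast)

text \<open>The cells along a sequence are nested nonempty compact sets, so they have a common
  point.\<close>

lemma coding_map_in: "coding_map w K \<sigma> \<in> foldr w (prefix_word \<sigma> n) ` K"
proof -
  have "(\<Inter>n. foldr w (prefix_word \<sigma> n) ` K) \<noteq> {}"
    by (rule compact_nest) (use nonempty foldr_w_prefix_mono in \<open>auto intro: compact_foldr_w\<close>)
  then obtain x where x: "\<And>n. x \<in> foldr w (prefix_word \<sigma> n) ` K" by blast
  show ?thesis unfolding coding_map_eqI[OF x] by (rule x)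
qed

lemma coding_map_in_K: "coding_map w K \<sigma> \<in> K"
  using coding_map_in[of \<sigma> 0] by simp

lemma dist_coding_map_le:
  assumes "prefix_word \<sigma> n = prefix_word \<tau> n"
  shows "dist (coding_map w K \<sigma>) (coding_map w K \<tau>) \<le> (1 / 2) ^ n * diameter K"
  using dist_foldr_w_le[of _ "prefix_word \<sigma> n"] coding_map_in[of \<sigma> n] coding_map_in[of \<tau> n] assms
  by auto

lemma coding_map_surj: "coding_map w K ` UNIV = K"
proof
  show "K \<subseteq> coding_map w K ` UNIV"
  proof
    fix x assume "x \<in> K"
    have "\<forall>y\<in>K. \<exists>jz. snd jz \<in> K \<and> y = w (fst jz) (snd jz)"
      using self_similar by fastforce
    then obtain F where F: "\<And>y. y \<in> K \<Longrightarrow> snd (F y) \<in> K \<and> y = w (fst (F y)) (snd (F y))"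
      by metis
    \<comment> \<open>Here \<open>z n\<close> is what remains of x after n inverse branches have
      been chosen, and \<open>\<sigma> n\<close> is the branch taken next.\<close>
    define z where "z = (\<lambda>n. ((snd \<circ> F) ^^ n) x)"
    define \<sigma> where "\<sigma> = (\<lambda>n. fst (F (z n)))"
    have zK: "z n \<in> K" for n
      by (induction n) (use \<open>x \<in> K\<close> F in \<open>auto simp: z_def\<close>)
    have zw: "z n = w (\<sigma> n) (z (Suc n))" for n
      using F[OF zK[of n]] by (simp add: \<sigma>_def z_def)
    have "x = foldr w (prefix_word \<sigma> n) (z n)" for n
    proof (induction n)
      case 0 show ?case by (simp add: z_def)
    next
      case (Suc n)
      then show ?case by (simp add: prefix_word_Suc flip: zw)
    qed
    then have "x \<in> foldr w (prefix_word \<sigma> n) ` K" for n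
      using zK by blast
    then show "x \<in> coding_map w K ` UNIV"
      by (metis coding_map_eqI rangeI)
  qed
qed (use coding_map_in_K in blast)

lemma coding_map_word_ext_Cons: "coding_map w K (word_ext (j # s)) = w j (coding_map w K (word_ext s))"
proof (rule coding_map_eqI)
  fix n
  show "w j (coding_map w K (word_ext s)) \<in> foldr w (prefix_word (word_ext (j # s)) n) ` K"
  proof (cases n)
    case 0
    then show ?thesis by (simp add: w_in_K coding_map_in_K)
  next
    case (Suc m)
    have "prefix_word (word_ext (j # s)) n = j # prefix_word (word_ext s) m"
      unfolding Suc by (simp add: prefix_word_def upt_conv_Cons word_ext_def flip: map_Suc_upt del: upt_Suc)
    then show ?thesis
      using coding_map_in[of "word_ext s" m] by auto
  qed
qed

lemma coding_map_word_ext: "coding_map w K (word_ext s) = foldr w s (v 2)"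
proof (induction s)
  case Nil
  have "word_ext [2] = word_ext []"
    by (auto simp: word_ext_def fun_eq_iff)
  then have "coding_map w K (word_ext []) = w 2 (coding_map w K (word_ext []))"
    using coding_map_word_ext_Cons[of 2 "[]"] by simp
  \<comment> \<open>Membership of \<open>v 2\<close> in K is not known beforehand; instead, both
    points are fixed by the contraction \<open>w 2\<close>, so their distance is half of
    itself.\<close>
  then have "dist (coding_map w K (word_ext [])) (v 2) = 1 / 2 * dist (coding_map w K (word_ext [])) (v 2)"
    by (metis ratio w_v2)
  then show ?case by simp
next
  case (Cons j s)
  then show ?case by (simp add: coding_map_word_ext_Cons)
qed

lemma w_2_funpow_v2: "(w 2 ^^ k) (v 2) = v 2"
  by (induction k) (simp_all add: w_v2)

text \<open>The tail of 2s fixes \<open>v 2\<close>, and \<open>w 1\<close> and \<open>w 3\<close>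
  send it to \<open>v 1\<close> and \<open>v 3\<close>. Modulo 3 we have j - 1 = j + 2, so
  \<open>w j (v 1)\<close> and \<open>w (j + 2) (v 3)\<close> are the same midpoint.\<close>

lemma coding_map_identify:
  "coding_map w K (word_ext (t @ j # 1 # replicate k 2))
    = coding_map w K (word_ext (t @ (j + 2) # 3 # replicate k 2))"
proof -
  have "w j (v 1) = w (j + 2) (v 3)"
  proof -
    have "j + 2 + 1 = j" "j - 1 = j + 2" by simp_all
    then show ?thesis by (simp only: w_v1 w_v3 midpoint_sym[of "v j"])
  qed
  then show ?thesis by (simp add: coding_map_word_ext w_2_funpow_v2 w_v2)
qed

text \<open>f is uniformly continuous on the compact K, and sequences with a long common prefix are
  coded into one small cell.\<close>

lemma comp_coding_map_in_C_cantor: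
  assumes "continuous_on K f"
  shows "f \<circ> coding_map w K \<in> C_cantor"
  unfolding C_cantor_iff
proof (intro allI impI)
  fix e :: real assume "e > 0"
  then obtain d where d: "d > 0" "\<And>x y. x \<in> K \<Longrightarrow> y \<in> K \<Longrightarrow> dist y x < d \<Longrightarrow> dist (f y) (f x) < e"
    using compact_uniformly_continuous[OF assms compact] unfolding uniformly_continuous_on_def by metis
  have "(\<lambda>n. (1 / 2) ^ n * diameter K) \<longlonglongrightarrow> 0 * diameter K"
    by (intro tendsto_mult LIMSEQ_realpow_zero tendsto_const) auto
  then have "\<forall>\<^sub>F n in sequentially. (1 / 2) ^ n * diameter K < d"
    using d(1) by (intro order_tendstoD(2)[of _ 0]) simp_all
  then obtain n where n: "(1 / 2) ^ n * diameter K < d"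
    using eventually_happens by fastforce
  have "dist ((f \<circ> coding_map w K) \<sigma>) ((f \<circ> coding_map w K) \<tau>) < e"
    if "prefix_word \<sigma> n = prefix_word \<tau> n" for \<sigma> \<tau>
    using dist_coding_map_le[OF that] n by (auto intro!: d(2) coding_map_in_K)
  then show "\<exists>n. \<forall>\<sigma> \<tau>. prefix_word \<sigma> n = prefix_word \<tau> n \<longrightarrow>
      dist ((f \<circ> coding_map w K) \<sigma>) ((f \<circ> coding_map w K) \<tau>) < e"
    by blast
qed

lemma uniform_function_algebra_continuous:
  "uniform_function_algebra K {f :: real^2 \<Rightarrow> complex. continuous_on K f}"
proof
  fix f :: "real^2 \<Rightarrow> complex"
  assume "f \<in> {f. continuous_on K f}"
  then have "compact ((\<lambda>x. cmod (f x)) ` K)"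
    by (intro compact_continuous_image compact continuous_on_norm) simp
  then show "bdd_above ((\<lambda>x. cmod (f x)) ` K)"
    by (intro bounded_imp_bdd_above compact_imp_bounded)
next
  fix fs and f :: "real^2 \<Rightarrow> complex"
  assume "\<And>n :: nat. fs n \<in> {f. continuous_on K f}" "uniform_limit K fs f sequentially"
  then show "f \<in> {f. continuous_on K f}"
    using uniform_limit_theorem[of K fs sequentially f] by simp
qed (auto simp: nonempty intro!: continuous_intros)

lemma isometric_star_hom_gasket_embedding:
  assumes "isometric_star_hom UNIV C_cantor (cantor_embedding \<phi>)"
  shows "isometric_star_hom K {f. continuous_on K f} (gasket_embedding \<phi> w K)"
proof -
  let ?P = "coding_map w K"
  have C: "(\<lambda>\<sigma>. f (?P \<sigma>)) \<in> C_cantor" if "f \<in> {f. continuous_on K f}" for f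
    using comp_coding_map_in_C_cantor[of f] that by (simp add: comp_def)
  \<comment> \<open>Surjectivity of the coding map onto K makes composition with it
    isometric.\<close>
  have "(SUP \<sigma>. cmod (f (?P \<sigma>))) = (SUP x\<in>K. cmod (f x))" for f
    using image_image[of "\<lambda>x. cmod (f x)" ?P UNIV] by (simp only: coding_map_surj)
  then show ?thesis
    unfolding isometric_star_hom_def gasket_embedding_def comp_def
    by (intro conjI ballI allI)
      (simp_all only: C isometric_star_homD[OF assms])
qed

end

lemma gasket_embedding_in_A_infinity:
  assumes "uhf3 \<phi>" "sierpinski_gasket v w K" "continuous_on K f"
  shows "gasket_embedding \<phi> w K f \<in> A_infinity \<phi>"
proof -
  interpret uhf3 \<phi> by fact
  interpret sierpinski_gasket v w K by fact
  let ?g = "f \<circ> coding_map w K"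
  \<comment> \<open>The shift by one is needed because \<open>A_level \<phi> n\<close> sits inside
    the image of matrix level n + 1.\<close>
  have "(\<lambda>n. diag_elem (n + 1) (\<lambda>s. ?g (word_ext s))) \<longlonglongrightarrow> gasket_embedding \<phi> w K f"
    unfolding gasket_embedding_def
    by (rule LIMSEQ_ignore_initial_segment[OF cantor_embedding_LIMSEQ[OF comp_coding_map_in_C_cantor[OF assms(3)]]])
  moreover have "diag_elem (n + 1) (\<lambda>s. ?g (word_ext s)) \<in> A_level \<phi> n" for n
    by (rule diag_elem_in_A_level) (simp add: coding_map_identify)
  ultimately have "\<exists>s. (\<forall>n. s n \<in> A_level \<phi> n) \<and> s \<longlonglongrightarrow> gasket_embedding \<phi> w K f"
    by (intro exI conjI allI)
  then show ?thesis
    by (simp add: A_infinity_def)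
qed

theorem theorem2p10:
  fixes \<phi> :: "nat \<Rightarrow> word_matrix \<Rightarrow> 'a::cstar_algebra"
    and v :: "3 \<Rightarrow> real^2" and w :: "3 \<Rightarrow> real^2 \<Rightarrow> real^2" and K :: "(real^2) set"
  assumes "uhf3 \<phi>"
    and "sierpinski_gasket v w K"
  defines "CK \<equiv> {f :: real^2 \<Rightarrow> complex. continuous_on K f}"
  shows "cstar_subalgebra (A_infinity \<phi>) \<and>
    isometric_star_hom K CK (gasket_embedding \<phi> w K) \<and>
    gasket_embedding \<phi> w K ` CK \<subseteq> A_infinity \<phi> \<and>
    cstar_subalgebra (gasket_embedding \<phi> w K ` CK) \<and>
    (\<forall>a \<in> gasket_embedding \<phi> w K ` CK. \<forall>b \<in> gasket_embedding \<phi> w K ` CK. a * b = b * a)"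
proof -
  interpret uhf3 \<phi> by fact
  interpret sierpinski_gasket v w K by fact
  interpret CK: uniform_function_algebra K CK
    unfolding CK_def by (rule uniform_function_algebra_continuous)
  have hom: "isometric_star_hom K CK (gasket_embedding \<phi> w K)"
    using is_cantor_embedding_cantor_embedding isometric_star_hom_gasket_embedding
    unfolding is_cantor_embedding_def CK_def by blast
  show ?thesis
  proof (intro conjI ballI hom cstar_subalgebra_A_infinity)
    show "gasket_embedding \<phi> w K ` CK \<subseteq> A_infinity \<phi>"
      using gasket_embedding_in_A_infinity[OF assms(1,2)] by (auto simp: CK_def)
    show "cstar_subalgebra (gasket_embedding \<phi> w K ` CK)"
      by (rule CK.cstar_subalgebra_hom_image[OF hom])
    show "a * b = b * a" if "a \<in> gasket_embedding \<phi> w K ` CK" "b \<in> gasket_embedding \<phi> w K ` CK" for a b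
      by (rule CK.hom_image_commute[OF hom that])
  qed
qed

end
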